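(* Let $X$ be a complex Banach space and let $T\in B(X)$. If $T$ is decomposable and $K\in B(X)$ is an algebraic operator which commutes with $T$, then $T+K$ is decomposable.
   Context: $B(X)$ is the Banach algebra of bounded linear operators on $X$. An operator $T\in B(X)$ is decomposable if for every open cover $\{U,V\}$ of $\mathbb{C}$ there are closed $T$-invariant subspaces $Y,Z\subset X$ with $X=Y+Z$, $\sigma(T|_Y)\subset U$ and $\sigma(T|_Z)\subset V$. Equivalently (well known), $T$ has both Bishop's property $(\beta)$ and the decomposition property $(\delta)$, where: $T$ has property $(\beta)$ if for every open $U\subset\mathbb{C}$ and every sequence of analytic functions $f_n:U\to X$, $(T-\lambda I)f_n(\lambda)\to 0$ uniformly on compact subsets of $U$ implies $f_n\to 0$ uniformly on compact subsets of $U$; and $T$ has property $(\delta)$ if the dual operator $T^*$ on $X^*$ has property $(\beta)$. An operator $K\in B(X)$ is algebraic if there is a nonzero complex polynomial $p$ with $p(K)=0$. *)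

theory Defs
  imports "HOL-Analysis.Analysis" "HOL-Computational_Algebra.Polynomial"
begin

text \<open>
  Complex Banach spaces: a real Banach space whose real scalar multiplication is extended to a
  complex one, with the norm homogeneous over the complex numbers. As for
  \<^class>\<open>banach\<close>, the zero space is included.
\<close>

class complex_banach = banach +
  fixes scaleC :: "complex \<Rightarrow> 'a \<Rightarrow> 'a"  (infixr \<open>*\<^sub>C\<close> 75)
  assumes scaleC_add_right: "a *\<^sub>C (x + y) = a *\<^sub>C x + a *\<^sub>C y"
    and scaleC_add_left: "(a + b) *\<^sub>C x = a *\<^sub>C x + b *\<^sub>C x"
    and scaleC_scaleC: "a *\<^sub>C (b *\<^sub>C x) = (a * b) *\<^sub>C x"
    and scaleC_of_real: "of_real r *\<^sub>C x = r *\<^sub>R x"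
    and norm_scaleC: "norm (a *\<^sub>C x) = cmod a * norm x"

lemma scaleC_one: "1 *\<^sub>C x = (x::'a::complex_banach)"
  using scaleC_of_real[of 1 x] by simp

global_interpretation complex_vector:
  vector_space "scaleC :: complex \<Rightarrow> 'a \<Rightarrow> 'a::complex_banach"
  defines csubspace = complex_vector.subspace
  by unfold_locales (simp_all add: scaleC_add_right scaleC_add_left scaleC_scaleC scaleC_one)

instantiation complex :: complex_banach
begin

definition scaleC_complex :: "complex \<Rightarrow> complex \<Rightarrow> complex"
  where "scaleC_complex a x = a * x"

instance
  by standard (simp_all add: scaleC_complex_def algebra_simps norm_mult scaleR_conv_of_real)

end

definition bounded_clinear :: "('a::complex_banach \<Rightarrow> 'a) \<Rightarrow> bool"
  where "bounded_clinear T \<longleftrightarrow> bounded_linear T \<and> (\<forall>c x. T (c *\<^sub>C x) = c *\<^sub>C T x)"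

text \<open>
  Membership in the algebra of bounded operators on a closed subspace \<open>Y\<close>. Subspaces are sets, so
  an operator on \<open>Y\<close> is represented by any total function whose restriction to \<open>Y\<close> it is; values
  outside \<open>Y\<close> are irrelevant.
\<close>

definition bounded_clinear_on :: "'a::complex_banach set \<Rightarrow> ('a \<Rightarrow> 'a) \<Rightarrow> bool"
  where "bounded_clinear_on Y S \<longleftrightarrow>
    S ` Y \<subseteq> Y \<and>
    (\<forall>x\<in>Y. \<forall>y\<in>Y. S (x + y) = S x + S y) \<and>
    (\<forall>c. \<forall>x\<in>Y. S (c *\<^sub>C x) = c *\<^sub>C S x) \<and>
    (\<exists>M. \<forall>x\<in>Y. norm (S x) \<le> norm x * M)"

lemma bounded_clinear_on_UNIV: "bounded_clinear_on UNIV T \<longleftrightarrow> bounded_clinear T"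
proof
  assume T: "bounded_clinear_on UNIV T"
  then have hom: "T (c *\<^sub>C x) = c *\<^sub>C T x" for c x
    by (simp add: bounded_clinear_on_def)
  have "T (r *\<^sub>R x) = r *\<^sub>R T x" for r x
    using hom[of "of_real r" x] by (simp add: scaleC_of_real)
  with T hom show "bounded_clinear T"
    unfolding bounded_clinear_def bounded_clinear_on_def
    by (auto intro!: bounded_linear.intro linearI bounded_linear_axioms.intro)
next
  assume "bounded_clinear T"
  then show "bounded_clinear_on UNIV T"
    unfolding bounded_clinear_def bounded_clinear_on_def
    by (auto simp: linear_add[OF bounded_linear.linear] intro: bounded_linear.bounded)
qed

text \<open>
  The spectrum of the restriction of \<open>T\<close> to a \<open>T\<close>-invariant closed subspace \<open>Y\<close>, computed in the
  algebra of bounded operators on \<open>Y\<close>. It is empty for \<open>Y = {0}\<close>.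
\<close>

definition spectrum_on :: "'a::complex_banach set \<Rightarrow> ('a \<Rightarrow> 'a) \<Rightarrow> complex set"
  where "spectrum_on Y T = {\<mu>. \<not> (\<exists>R. bounded_clinear_on Y R \<and>
    (\<forall>y\<in>Y. R (T y - \<mu> *\<^sub>C y) = y) \<and> (\<forall>y\<in>Y. T (R y) - \<mu> *\<^sub>C R y = y))}"

definition closed_invariant_subspace :: "('a::complex_banach \<Rightarrow> 'a) \<Rightarrow> 'a set \<Rightarrow> bool"
  where "closed_invariant_subspace T Y \<longleftrightarrow> csubspace Y \<and> closed Y \<and> T ` Y \<subseteq> Y"

definition decomposable :: "('a::complex_banach \<Rightarrow> 'a) \<Rightarrow> bool"
  where "decomposable T \<longleftrightarrow> bounded_clinear T \<and>
    (\<forall>U V. open U \<and> open V \<and> U \<union> V = UNIV \<longrightarrow>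
      (\<exists>Y Z. closed_invariant_subspace T Y \<and> closed_invariant_subspace T Z \<and>
        {y + z | y z. y \<in> Y \<and> z \<in> Z} = UNIV \<and>
        spectrum_on Y T \<subseteq> U \<and> spectrum_on Z T \<subseteq> V))"

definition poly_op :: "complex poly \<Rightarrow> ('a::complex_banach \<Rightarrow> 'a) \<Rightarrow> 'a \<Rightarrow> 'a"
  where "poly_op p K = (\<lambda>x. \<Sum>i\<le>degree p. coeff p i *\<^sub>C (K ^^ i) x)"

definition algebraic_operator :: "('a::complex_banach \<Rightarrow> 'a) \<Rightarrow> bool"
  where "algebraic_operator K \<longleftrightarrow>
    bounded_clinear K \<and> (\<exists>p. p \<noteq> 0 \<and> poly_op p K = (\<lambda>x. 0))"

end

theory Submission
  imports Defs "HOL-Computational_Algebra.Fundamental_Theorem_Algebra"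
begin

text \<open>
  Split \<open>X\<close> by the Riesz idempotents of \<open>K\<close>, which are polynomials in \<open>K\<close>. On each summand \<open>K\<close> is a
  scalar \<open>l\<close> plus a nilpotent operator commuting with \<open>T\<close>, so that the spectrum of \<open>T + K\<close> on a
  subspace invariant under \<open>T\<close> and \<open>K\<close> is that of \<open>T\<close> shifted by \<open>l\<close>. It remains to decompose \<open>X\<close>,
  for the cover \<open>{U - l, V - l}\<close>, into subspaces that are invariant under \<open>K\<close> as well. The local
  spectral subspaces of \<open>T\<close> are invariant under all operators commuting with \<open>T\<close>; for decomposable
  \<open>T\<close> and closed \<open>F\<close> they are closed and carry a spectrum inside \<open>F\<close>, because local resolvents are
  unique and depend continuously on the vector (Bishop's property).
\<close>


subsection \<open>Bounded operators and spectra on subspaces\<close>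

text \<open>Bishop's property is obtained with explicit constants. For two nearby radii,
  decomposability splits X into a part where T - \<mu> has small spectral radius and a part where
  its inverse does; the gap between the radii turns into geometric decay. Hence the need for a
  spectral radius formula on subspaces, and for local resolvents recorded by radius-weighted
  coefficient bounds. Every such estimate loses an arbitrarily small amount of radius. This is
  harmless for closed F, since a closed disc missing F can first be enlarged, but U and V are open,
  so they are shrunk to closed sets whose interiors still cover the plane.

  The nilpotent part of K raises another obstacle: the spectrum of T is controlled on a
  hyperinvariant subspace W, while K - l is nilpotent only on the vectors of W in the range of the
  idempotent. The perturbation argument therefore uses the resolvent of T on all of W and restricts
  the vectors to the kernel of a power of K - l.\<close>

lemma bounded_clinear_scaleC: "bounded_clinear T \<Longrightarrow> T (c *\<^sub>C x) = c *\<^sub>C T x"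
  by (simp add: bounded_clinear_def)

lemma bounded_clinear_linear: "bounded_clinear T \<Longrightarrow> linear T"
  by (simp add: bounded_clinear_def bounded_linear.linear)

lemmas bounded_clinear_simps =
  linear_add[OF bounded_clinear_linear] linear_diff[OF bounded_clinear_linear]
  linear_0[OF bounded_clinear_linear] linear_sum[OF bounded_clinear_linear]
  bounded_clinear_scaleC

lemma bounded_clinear_bound:
  assumes "bounded_clinear T"
  obtains B where "B > 0" "\<And>x. norm (T x) \<le> B * norm x"
  using assms bounded_linear.pos_bounded[of T]
  by (auto simp: bounded_clinear_def mult.commute)

lemma bounded_linear_scaleC_right: "bounded_linear (\<lambda>x::'a::complex_banach. c *\<^sub>C x)"
proof (rule bounded_linear_intro[where K = "cmod c"])
  fix r and x :: 'a
  show "c *\<^sub>C (r *\<^sub>R x) = r *\<^sub>R (c *\<^sub>C x)"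
    by (simp flip: scaleC_of_real add: scaleC_scaleC mult.commute)
qed (simp_all add: scaleC_add_right norm_scaleC mult.commute)

lemma bounded_clinear_scaleC_id: "bounded_clinear (\<lambda>x. c *\<^sub>C x)"
  by (simp add: bounded_clinear_def bounded_linear_scaleC_right scaleC_scaleC mult.commute)

lemma bounded_clinear_ident: "bounded_clinear (\<lambda>x. x)"
  by (simp add: bounded_clinear_def bounded_linear_ident)

lemma bounded_clinear_compose:
  "bounded_clinear S \<Longrightarrow> bounded_clinear T \<Longrightarrow> bounded_clinear (\<lambda>x. S (T x))"
  by (auto simp: bounded_clinear_def intro: bounded_linear_compose)

lemma bounded_clinear_add:
  "bounded_clinear S \<Longrightarrow> bounded_clinear T \<Longrightarrow> bounded_clinear (\<lambda>x. S x + T x)"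
  by (auto simp: bounded_clinear_def scaleC_add_right intro: bounded_linear_add)

lemma bounded_clinear_diff:
  "bounded_clinear S \<Longrightarrow> bounded_clinear T \<Longrightarrow> bounded_clinear (\<lambda>x. S x - T x)"
  by (auto simp: bounded_clinear_def complex_vector.scale_right_diff_distrib
      intro: bounded_linear_sub)

lemma bounded_clinear_shift:
  "bounded_clinear T \<Longrightarrow> bounded_clinear (\<lambda>x. T x - c *\<^sub>C x)"
  by (intro bounded_clinear_diff bounded_clinear_scaleC_id)

lemma bounded_clinear_funpow: "bounded_clinear T \<Longrightarrow> bounded_clinear (T ^^ n)"
  by (induction n)
    (simp_all add: bounded_clinear_ident[folded id_def] bounded_clinear_compose comp_def)

lemma bounded_clinear_continuous: "bounded_clinear T \<Longrightarrow> continuous_on A T"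
  by (simp add: bounded_clinear_def linear_continuous_on)

lemma bounded_clinear_on_subspace:
  assumes "bounded_clinear T" "T ` Y \<subseteq> Y"
  shows "bounded_clinear_on Y T"
proof -
  obtain B where "\<And>x. norm (T x) \<le> B * norm x"
    using bounded_clinear_bound[OF assms(1)] by metis
  then show ?thesis
    using assms unfolding bounded_clinear_on_def
    by (auto simp: bounded_clinear_simps mult.commute)
qed

lemma bounded_clinear_onD:
  assumes "bounded_clinear_on Y S"
  shows "y \<in> Y \<Longrightarrow> S y \<in> Y"
    and "x \<in> Y \<Longrightarrow> y \<in> Y \<Longrightarrow> S (x + y) = S x + S y"
    and "x \<in> Y \<Longrightarrow> S (c *\<^sub>C x) = c *\<^sub>C S x"
  using assms by (auto simp: bounded_clinear_on_def)

lemma bounded_clinear_on_bound: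
  assumes "bounded_clinear_on Y S"
  obtains B where "B > 0" "\<And>x. x \<in> Y \<Longrightarrow> norm (S x) \<le> B * norm x"
proof -
  obtain M where M: "\<And>x. x \<in> Y \<Longrightarrow> norm (S x) \<le> norm x * M"
    using assms unfolding bounded_clinear_on_def by blast
  have "norm (S x) \<le> (\<bar>M\<bar> + 1) * norm x" if "x \<in> Y" for x
  proof -
    have "norm x * M \<le> norm x * (\<bar>M\<bar> + 1)"
      by (intro mult_left_mono) auto
    with M[OF that] show ?thesis by (simp add: mult.commute)
  qed
  then show ?thesis using that[of "\<bar>M\<bar> + 1"] by (simp add: add_nonneg_pos)
qed

lemma bounded_clinear_on_0:
  assumes "csubspace Y" "bounded_clinear_on Y S"
  shows "S 0 = 0"
  using bounded_clinear_onD(3)[OF assms(2) complex_vector.subspace_0[OF assms(1)], of 0] by simp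

lemma bounded_clinear_on_diff:
  assumes "csubspace Y" "bounded_clinear_on Y S" "x \<in> Y" "y \<in> Y"
  shows "S (x - y) = S x - S y"
  using bounded_clinear_onD(2)[OF assms(2), of "x - y" y] assms
  by (simp add: complex_vector.subspace_diff)

lemma bounded_clinear_on_sum:
  assumes "csubspace Y" "bounded_clinear_on Y S" "\<And>i. i \<in> I \<Longrightarrow> f i \<in> Y"
  shows "S (sum f I) = (\<Sum>i\<in>I. S (f i))"
  using assms(3)
proof (induction I rule: infinite_finite_induct)
  case (insert i I)
  then have "sum f I \<in> Y" by (intro complex_vector.subspace_sum assms(1)) auto
  with insert show ?case by (simp add: bounded_clinear_onD(2)[OF assms(2)])
qed (simp_all add: bounded_clinear_on_0[OF assms(1,2)])

lemma bounded_clinear_on_funpow: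
  assumes "bounded_clinear_on Y S"
  shows "bounded_clinear_on Y (S ^^ n)"
proof (induction n)
  case 0
  then show ?case by (auto simp: bounded_clinear_on_def intro: exI[of _ 1])
next
  case (Suc n)
  obtain B where B: "B > 0" "\<And>x. x \<in> Y \<Longrightarrow> norm (S x) \<le> B * norm x"
    using bounded_clinear_on_bound[OF assms] by blast
  obtain C where C: "C > 0" "\<And>x. x \<in> Y \<Longrightarrow> norm ((S ^^ n) x) \<le> C * norm x"
    using bounded_clinear_on_bound[OF Suc] by blast
  have "norm (S ((S ^^ n) x)) \<le> norm x * (B * C)" if "x \<in> Y" for x
  proof -
    have "norm (S ((S ^^ n) x)) \<le> B * norm ((S ^^ n) x)"
      by (intro B bounded_clinear_onD(1)[OF Suc] that)
    also have "\<dots> \<le> B * (C * norm x)"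
      using B(1) by (intro mult_left_mono C that) auto
    finally show ?thesis by (simp add: mult_ac)
  qed
  then show ?case
    using assms Suc by (auto simp: bounded_clinear_on_def image_subset_iff)
qed

text \<open>The lower bound does double duty: it makes the chosen preimages unique, hence linear in
  \<open>y\<close>, and it bounds them. The spectra of T on local spectral subspaces and of T + K on
  combined subspaces are both controlled in this way.\<close>

lemma notin_spectrum_onI:
  assumes Y: "csubspace Y" and T: "bounded_clinear T"
    and surj: "\<And>y. y \<in> Y \<Longrightarrow> \<exists>u\<in>Y. T u - \<mu> *\<^sub>C u = y"
    and bound: "\<And>u. u \<in> Y \<Longrightarrow> norm u \<le> C * norm (T u - \<mu> *\<^sub>C u)"
    and TY: "T ` Y \<subseteq> Y"
  shows "\<mu> \<notin> spectrum_on Y T"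
proof -
  note lin = bounded_clinear_simps[OF bounded_clinear_shift[OF T, of \<mu>]]
  have inj: "u = u'" if "u \<in> Y" "u' \<in> Y" "T u - \<mu> *\<^sub>C u = T u' - \<mu> *\<^sub>C u'" for u u'
    using bound[of "u - u'"] that by (simp add: lin complex_vector.subspace_diff[OF Y])
  obtain R where R: "\<And>y. y \<in> Y \<Longrightarrow> R y \<in> Y \<and> T (R y) - \<mu> *\<^sub>C R y = y"
    using surj by metis
  have Req: "R y = u" if "y \<in> Y" "u \<in> Y" "T u - \<mu> *\<^sub>C u = y" for y u
    using inj[of "R y" u] R[of y] that by simp
  have "bounded_clinear_on Y R"
    unfolding bounded_clinear_on_def
  proof (intro conjI ballI allI exI)
    show "R ` Y \<subseteq> Y" using R by auto
    show "R (x + y) = R x + R y" if "x \<in> Y" "y \<in> Y" for x y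
      using that R by (intro Req) (auto simp: complex_vector.subspace_add[OF Y] lin)
    show "R (c *\<^sub>C x) = c *\<^sub>C R x" if "x \<in> Y" for c x
      using that R
      by (intro Req) (auto simp: complex_vector.subspace_scale[OF Y] lin
          simp del: complex_vector.scale_scale)
    show "norm (R x) \<le> norm x * C" if "x \<in> Y" for x
      using bound[of "R x"] R[OF that] by (simp add: mult.commute)
  qed
  moreover have "R (T y - \<mu> *\<^sub>C y) = y" if "y \<in> Y" for y
    using that TY
    by (intro Req) (auto intro!: complex_vector.subspace_diff complex_vector.subspace_scale Y)
  ultimately show ?thesis
    using R by (auto simp: spectrum_on_def)
qed

lemma notin_spectrum_onE:
  assumes "\<mu> \<notin> spectrum_on Y T"
  obtains R where "bounded_clinear_on Y R" "\<And>y. y \<in> Y \<Longrightarrow> R (T y - \<mu> *\<^sub>C y) = y"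
    "\<And>y. y \<in> Y \<Longrightarrow> T (R y) - \<mu> *\<^sub>C R y = y"
  using assms by (auto simp: spectrum_on_def)

text \<open>A lower bound at \<nu> survives on a small ball around \<nu> with twice the constant;
  compactness leaves finitely many constants.\<close>

lemma pencil_uniform_lower_bound:
  fixes S :: "'a::complex_banach \<Rightarrow> 'a"
  assumes B: "B \<ge> 0" "\<And>u. u \<in> Y \<Longrightarrow> norm (S u) \<le> B * norm u"
    and D: "compact D"
    and bound: "\<And>\<nu>. \<nu> \<in> D \<Longrightarrow> \<exists>C. \<forall>u\<in>Y. norm u \<le> C * norm (u - \<nu> *\<^sub>C S u)"
  obtains C where "C > 0"
    "\<And>\<nu> u. \<nu> \<in> D \<Longrightarrow> u \<in> Y \<Longrightarrow> norm u \<le> C * norm (u - \<nu> *\<^sub>C S u)"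
proof -
  obtain c where c: "\<And>\<nu> u. \<nu> \<in> D \<Longrightarrow> u \<in> Y \<Longrightarrow> norm u \<le> c \<nu> * norm (u - \<nu> *\<^sub>C S u)"
    using bound by metis
  define d where "d = (\<lambda>\<nu>. \<bar>c \<nu>\<bar> + 1)"
  have dpos: "d \<nu> > 0" for \<nu> by (simp add: d_def add_nonneg_pos)
  have d: "norm u \<le> d \<nu> * norm (u - \<nu> *\<^sub>C S u)" if "\<nu> \<in> D" "u \<in> Y" for \<nu> u
  proof -
    have "c \<nu> * norm (u - \<nu> *\<^sub>C S u) \<le> d \<nu> * norm (u - \<nu> *\<^sub>C S u)"
      by (intro mult_right_mono) (auto simp: d_def)
    with c[OF that] show ?thesis by linarith
  qed
  \<comment> \<open>With this radius the change of \<nu> costs at most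
    \<open>norm u / (2 * d \<nu>)\<close>, half of what the bound at \<nu> provides.
    \<open>B + 1\<close> avoids division by zero for \<open>B = 0\<close>.\<close>
  define e where "e = (\<lambda>\<nu>. 1 / (2 * d \<nu> * (B + 1)))"
  have e: "e \<nu> > 0" for \<nu> using dpos[of \<nu>] B(1) by (simp add: e_def)
  have near: "norm u \<le> 2 * d \<nu> * norm (u - \<nu>' *\<^sub>C S u)"
    if "\<nu> \<in> D" "u \<in> Y" "\<nu>' \<in> ball \<nu> (e \<nu>)" for \<nu> \<nu>' u
  proof -
    have "norm (u - \<nu> *\<^sub>C S u) = norm ((u - \<nu>' *\<^sub>C S u) + (\<nu>' - \<nu>) *\<^sub>C S u)"
      by (simp add: complex_vector.scale_left_diff_distrib)
    also have "\<dots> \<le> norm (u - \<nu>' *\<^sub>C S u) + cmod (\<nu>' - \<nu>) * norm (S u)"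
      by (metis norm_triangle_ineq norm_scaleC)
    also have "cmod (\<nu>' - \<nu>) * norm (S u) \<le> e \<nu> * ((B + 1) * norm u)"
    proof (intro mult_mono)
      show "norm (S u) \<le> (B + 1) * norm u"
        using B(2)[OF that(2)] by (simp add: distrib_right add_increasing2)
    qed (use that e[of \<nu>] in \<open>auto simp: dist_norm norm_minus_commute less_imp_le\<close>)
    finally have "d \<nu> * norm (u - \<nu> *\<^sub>C S u)
        \<le> d \<nu> * (norm (u - \<nu>' *\<^sub>C S u) + e \<nu> * ((B + 1) * norm u))"
      using dpos[of \<nu>] by (intro mult_left_mono) auto
    also have "\<dots> = d \<nu> * norm (u - \<nu>' *\<^sub>C S u) + norm u / 2"
      using dpos[of \<nu>] B(1) by (simp add: e_def field_simps add_nonneg_eq_0_iff)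
    finally show ?thesis using d[OF that(1,2)] by linarith
  qed
  obtain D' where D': "D' \<subseteq> D" "finite D'" "D \<subseteq> (\<Union>\<nu>\<in>D'. ball \<nu> (e \<nu>))"
  proof (rule compactE_image[OF D, of D "\<lambda>\<nu>. ball \<nu> (e \<nu>)"])
    show "D \<subseteq> (\<Union>\<nu>\<in>D. ball \<nu> (e \<nu>))" using e by fastforce
  qed auto
  \<comment> \<open>A sum in place of a maximum, with 1 added so that an empty \<open>D'\<close>
    still gives a positive constant.\<close>
  define C where "C = 1 + (\<Sum>\<nu>\<in>D'. 2 * d \<nu>)"
  have "C > 0" unfolding C_def using dpos by (simp add: add_pos_nonneg sum_nonneg less_imp_le)
  moreover have "norm u \<le> C * norm (u - \<nu>' *\<^sub>C S u)" if u: "u \<in> Y" and "\<nu>' \<in> D" for \<nu>' u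
  proof -
    obtain \<nu> where \<nu>: "\<nu> \<in> D'" "\<nu>' \<in> ball \<nu> (e \<nu>)" using D' \<open>\<nu>' \<in> D\<close> by auto
    have "2 * d \<nu> \<le> (\<Sum>\<nu>\<in>D'. 2 * d \<nu>)"
      using D' \<nu> dpos by (intro member_le_sum) (auto simp: less_imp_le)
    then have "2 * d \<nu> \<le> C" by (simp add: C_def)
    then have "2 * d \<nu> * norm (u - \<nu>' *\<^sub>C S u) \<le> C * norm (u - \<nu>' *\<^sub>C S u)"
      by (intro mult_right_mono) auto
    with near[of \<nu> u \<nu>'] u \<nu> D' show ?thesis by (auto intro: order_trans)
  qed
  ultimately show ?thesis using that by blast
qed


subsection \<open>The spectral radius formula\<close>

text \<open>A geometric sum in j whose ratio is an n-th root of unity, different from 1 because 0 <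
  i < n.\<close>

lemma sum_root_of_unity_powers:
  fixes n i :: nat
  assumes "i < n"
  shows "(\<Sum>j<n. cis (2 * pi * j / n) ^ i) = (if i = 0 then of_nat n else 0)"
proof (cases "i = 0")
  case False
  define w where "w = cis (2 * pi * i / n)"
  have w: "cis (2 * pi * j / n) ^ i = w ^ j" for j :: nat
    unfolding w_def Complex.DeMoivre by (rule arg_cong[where f = cis]) simp
  have "w \<noteq> 1"
  proof
    assume "w = 1"
    then have "cos (2 * pi * i / n) = 1" by (simp add: w_def complex_eq_iff)
    then obtain k :: int where "2 * pi * i / n = of_int k * 2 * pi"
      by (auto simp: cos_one_2pi_int)
    then have "real i = of_int k * n" using assms by (simp add: field_simps)
    then have ik: "int i = k * int n" by (metis of_int_eq_iff of_int_mult of_int_of_nat_eq)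
    with False assms have "k > 0" by (metis mult_le_0_iff not_le of_nat_0_le_iff of_nat_0_eq_iff of_nat_le_0_iff)
    then have "int n \<le> k * int n" using mult_right_mono[of 1 k "int n"] by simp
    with ik assms show False by simp
  qed
  moreover have "w ^ n = 1" using assms by (simp add: w_def Complex.DeMoivre)
  ultimately show ?thesis
    using False by (simp add: w sum_gp_strict)
qed simp

lemma funpow_scaled_telescope:
  assumes Y: "csubspace Y" and S: "bounded_clinear_on Y S" and u: "u \<in> Y"
  shows "u - \<nu> ^ n *\<^sub>C (S ^^ n) u = (\<Sum>i<n. \<nu> ^ i *\<^sub>C (S ^^ i) (u - \<nu> *\<^sub>C S u))"
proof (induction n)
  case (Suc n)
  have S': "bounded_clinear_on Y (S ^^ n)" by (rule bounded_clinear_on_funpow[OF S])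
  have Su: "S u \<in> Y" using bounded_clinear_onD(1)[OF S u] .
  have "(S ^^ n) (u - \<nu> *\<^sub>C S u) = (S ^^ n) u - \<nu> *\<^sub>C (S ^^ Suc n) u"
    using u Su by (simp add: bounded_clinear_on_diff[OF Y S'] bounded_clinear_onD(3)[OF S']
        complex_vector.subspace_scale[OF Y] funpow_swap1)
  then show ?case
    by (simp add: Suc[symmetric] complex_vector.scale_right_diff_distrib mult.commute)
qed simp

text \<open>
  The spectral radius formula, by Rickart's argument: if \<open>Q \<nu>\<close> inverts \<open>1 - \<nu> S\<close> then the average
  of \<open>Q\<close> over \<open>n\<close> equidistant points of the circle of radius \<open>s\<close> inverts \<open>1 - s ^ n S ^ n\<close>, and
  these averages are equicontinuous in \<open>s\<close>, uniformly in \<open>n\<close>. So the decay of \<open>s ^ n S ^ n\<close> spreads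
  from \<open>s = 0\<close> to \<open>s = \<rho>\<close> in finitely many steps of equal length.
\<close>

lemma power_bound_of_invertible_pencil:
  assumes Y: "csubspace Y" and S: "bounded_clinear_on Y S" and \<rho>: "\<rho> \<ge> 0"
    and surj: "\<And>\<nu> y. cmod \<nu> \<le> \<rho> \<Longrightarrow> y \<in> Y \<Longrightarrow> \<exists>u\<in>Y. u - \<nu> *\<^sub>C S u = y"
    and bound: "\<And>\<nu>. cmod \<nu> \<le> \<rho> \<Longrightarrow> \<exists>C. \<forall>u\<in>Y. norm u \<le> C * norm (u - \<nu> *\<^sub>C S u)"
  obtains M where "M > 0" "\<And>n y. y \<in> Y \<Longrightarrow> norm ((S ^^ n) y) * \<rho> ^ n \<le> M * norm y"
proof -
  note [simp] = complex_vector.subspace_scale[OF Y] complex_vector.subspace_diff[OF Y]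
    complex_vector.subspace_add[OF Y] complex_vector.subspace_0[OF Y]
  have SY [simp]: "S y \<in> Y" if "y \<in> Y" for y using bounded_clinear_onD(1)[OF S that] .
  have SnY [simp]: "(S ^^ n) y \<in> Y" if "y \<in> Y" for y n
    using bounded_clinear_onD(1)[OF bounded_clinear_on_funpow[OF S] that] .
  obtain B where B: "B > 0" "\<And>u. u \<in> Y \<Longrightarrow> norm (S u) \<le> B * norm u"
    using bounded_clinear_on_bound[OF S] by blast
  obtain C where C: "C > 0"
    "\<And>\<nu> u. cmod \<nu> \<le> \<rho> \<Longrightarrow> u \<in> Y \<Longrightarrow> norm u \<le> C * norm (u - \<nu> *\<^sub>C S u)"
    using pencil_uniform_lower_bound[of B Y S "cball 0 \<rho>"] B bound by auto
  obtain Q where Q: "\<And>\<nu> y. cmod \<nu> \<le> \<rho> \<Longrightarrow> y \<in> Y \<Longrightarrow> Q \<nu> y \<in> Y \<and> Q \<nu> y - \<nu> *\<^sub>C S (Q \<nu> y) = y"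
    using surj by metis
  have Qn: "norm (Q \<nu> y) \<le> C * norm y" if "cmod \<nu> \<le> \<rho>" "y \<in> Y" for \<nu> y
    using C(2)[OF that(1), of "Q \<nu> y"] Q[OF that] by simp
  have QS: "Q \<nu> (S y) = S (Q \<nu> y)" if "cmod \<nu> \<le> \<rho>" "y \<in> Y" for \<nu> y
  proof -
    have [simp]: "Q \<nu> y \<in> Y" "Q \<nu> (S y) \<in> Y" using Q that by auto
    have "S (Q \<nu> y) - \<nu> *\<^sub>C S (S (Q \<nu> y)) = S (Q \<nu> y - \<nu> *\<^sub>C S (Q \<nu> y))"
      by (simp add: bounded_clinear_on_diff[OF Y S] bounded_clinear_onD(3)[OF S])
    also have "\<dots> = S y" using Q that by presburger
    finally have 1: "S (Q \<nu> y) - \<nu> *\<^sub>C S (S (Q \<nu> y)) = S y" .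
    have "Q \<nu> (S y) - S (Q \<nu> y) - \<nu> *\<^sub>C S (Q \<nu> (S y) - S (Q \<nu> y)) =
        (Q \<nu> (S y) - \<nu> *\<^sub>C S (Q \<nu> (S y))) - (S (Q \<nu> y) - \<nu> *\<^sub>C S (S (Q \<nu> y)))"
      by (simp add: bounded_clinear_on_diff[OF Y S] complex_vector.scale_right_diff_distrib)
    also have "\<dots> = 0" using that Q 1 by simp
    finally show ?thesis
      using C(2)[OF that(1), of "Q \<nu> (S y) - S (Q \<nu> y)"] that Q by simp
  qed
  \<comment> \<open>The resolvent identity
    \<open>Q \<nu> - Q \<nu>' = (\<nu> - \<nu>') Q \<nu> S Q \<nu>'\<close>, whose three factors
    account for C, B and C.\<close>
  have Qlip: "norm (Q \<nu> y - Q \<nu>' y) \<le> C * B * C * cmod (\<nu> - \<nu>') * norm y"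
    if "cmod \<nu> \<le> \<rho>" "cmod \<nu>' \<le> \<rho>" "y \<in> Y" for \<nu> \<nu>' y
  proof -
    let ?u = "Q \<nu> y" and ?u' = "Q \<nu>' y"
    have [simp]: "?u \<in> Y" "?u' \<in> Y" using Q that by auto
    have "(?u - ?u') - \<nu> *\<^sub>C S (?u - ?u') = (?u - \<nu> *\<^sub>C S ?u) - (?u' - \<nu>' *\<^sub>C S ?u') + (\<nu> - \<nu>') *\<^sub>C S ?u'"
      by (simp add: bounded_clinear_on_diff[OF Y S] complex_vector.scale_right_diff_distrib
          complex_vector.scale_left_diff_distrib)
    also have "\<dots> = (\<nu> - \<nu>') *\<^sub>C S ?u'" using Q that by simp
    finally have "norm (?u - ?u') \<le> C * norm ((\<nu> - \<nu>') *\<^sub>C S ?u')"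
      using C(2)[OF that(1), of "?u - ?u'"] by simp
    also have "\<dots> \<le> C * (cmod (\<nu> - \<nu>') * (B * (C * norm y)))"
    proof -
      have "norm (S ?u') \<le> B * norm ?u'" by (rule B) simp
      also have "\<dots> \<le> B * (C * norm y)" using B(1) Qn that by (intro mult_left_mono) auto
      finally show ?thesis using C(1) by (auto simp: norm_scaleC intro!: mult_left_mono)
    qed
    finally show ?thesis by (simp add: mult_ac)
  qed
  define \<omega> where "\<omega> = (\<lambda>n j. cis (2 * pi * real j / real n))"
  define A where "A = (\<lambda>n s y. (1 / real n) *\<^sub>R (\<Sum>j<n. Q (of_real s * \<omega> n j) y))"
  have [simp]: "cmod (of_real s * \<omega> n j) \<le> \<rho>" if "0 \<le> s" "s \<le> \<rho>" for n j s
    using that by (simp add: \<omega>_def norm_mult)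
  have QY [simp]: "Q (of_real s * \<omega> n j) y \<in> Y" if "0 \<le> s" "s \<le> \<rho>" "y \<in> Y" for n j s y
    using Q that by simp
  have Re: "r *\<^sub>R x = of_real r *\<^sub>C x" for r and x :: 'a by (simp add: scaleC_of_real)
  have [simp]: "A n s y \<in> Y" if "0 \<le> s" "s \<le> \<rho>" "y \<in> Y" for n s y
    unfolding A_def Re
    by (intro complex_vector.subspace_scale complex_vector.subspace_sum Y QY that)
  have Aavg: "norm ((1 / real n) *\<^sub>R (\<Sum>j<n. f j)) \<le> b" if "n > 0" "\<And>j. norm (f j) \<le> b" for n b and f :: "nat \<Rightarrow> 'a"
  proof -
    have "norm (\<Sum>j<n. f j) \<le> of_nat (card {..<n}) * b" by (rule sum_norm_bound) (rule that)
    then show ?thesis using that(1) by (simp add: field_simps)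
  qed
  have An: "norm (A n s y) \<le> C * norm y" if "0 \<le> s" "s \<le> \<rho>" "y \<in> Y" "n > 0" for n s y
    unfolding A_def using that by (intro Aavg Qn) auto
  have Alip: "norm (A n s y - A n s' y) \<le> C * B * C * \<bar>s - s'\<bar> * norm y"
    if "0 \<le> s" "s \<le> \<rho>" "0 \<le> s'" "s' \<le> \<rho>" "y \<in> Y" "n > 0" for n s s' y
  proof -
    have "norm (Q (of_real s * \<omega> n j) y - Q (of_real s' * \<omega> n j) y) \<le> C * B * C * \<bar>s - s'\<bar> * norm y" for j
    proof -
      have "cmod (of_real s * \<omega> n j - of_real s' * \<omega> n j) = \<bar>s - s'\<bar>"
        by (simp add: \<omega>_def norm_mult flip: left_diff_distrib of_real_diff)
      then show ?thesis
        using Qlip[of "of_real s * \<omega> n j" "of_real s' * \<omega> n j" y] that by simp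
    qed
    then show ?thesis
      unfolding A_def scaleR_diff_right[symmetric] sum_subtractf[symmetric]
      by (intro Aavg that(6))
  qed
  have Ainv: "A n s y - s ^ n *\<^sub>R (S ^^ n) (A n s y) = y"
    if s: "0 \<le> s" "s \<le> \<rho>" and y: "y \<in> Y" and n: "n > 0" for n s y
  proof -
    note Sn = bounded_clinear_on_funpow[OF S, of n]
    let ?u = "\<lambda>j. Q (of_real s * \<omega> n j) y"
    have pow: "\<omega> n j ^ n = 1" for j
    proof -
      have "real n * (2 * pi * real j / real n) = 2 * pi * real j" using n by simp
      then show ?thesis unfolding \<omega>_def Complex.DeMoivre by simp
    qed
    \<comment> \<open>All nodes have the same n-th power \<open>s ^ n\<close>, so one operator
      occurs on the left for every j. Summing over j kills every power of S on the right except the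
      zeroth.\<close>
    have "?u j - s ^ n *\<^sub>R (S ^^ n) (?u j) = (\<Sum>i<n. (of_real s * \<omega> n j) ^ i *\<^sub>C (S ^^ i) y)" for j
      using funpow_scaled_telescope[OF Y S, of "?u j" "of_real s * \<omega> n j" n] Q s y
      by (simp add: power_mult_distrib pow Re)
    then have "(\<Sum>j<n. ?u j - s ^ n *\<^sub>R (S ^^ n) (?u j))
        = (\<Sum>j<n. \<Sum>i<n. (of_real s * \<omega> n j) ^ i *\<^sub>C (S ^^ i) y)" by simp
    also have "\<dots> = (\<Sum>i<n. (of_real s ^ i * (\<Sum>j<n. \<omega> n j ^ i)) *\<^sub>C (S ^^ i) y)"
      by (subst sum.swap)
        (simp add: power_mult_distrib sum_distrib_left complex_vector.scale_sum_left)
    also have "\<dots> = (\<Sum>i<n. if i = 0 then of_nat n *\<^sub>C y else 0)"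
      unfolding \<omega>_def by (intro sum.cong) (auto simp: sum_root_of_unity_powers)
    also have "\<dots> = real n *\<^sub>R y" using n by (simp add: Re)
    finally have eq: "(\<Sum>j<n. ?u j - s ^ n *\<^sub>R (S ^^ n) (?u j)) = real n *\<^sub>R y" .
    have "(S ^^ n) (A n s y) = (1 / real n) *\<^sub>R (\<Sum>j<n. (S ^^ n) (?u j))"
      unfolding A_def Re using s y
      by (subst bounded_clinear_onD(3)[OF Sn])
        (auto simp: bounded_clinear_on_sum[OF Y Sn] intro: complex_vector.subspace_sum[OF Y])
    then have "A n s y - s ^ n *\<^sub>R (S ^^ n) (A n s y) = (1 / real n) *\<^sub>R (\<Sum>j<n. ?u j - s ^ n *\<^sub>R (S ^^ n) (?u j))"
      by (simp add: A_def sum_subtractf scaleR_diff_right scaleR_sum_right mult.commute)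
    then show ?thesis using eq n by simp
  qed
  have AS: "A n s ((S ^^ m) y) = (S ^^ m) (A n s y)" if s: "0 \<le> s" "s \<le> \<rho>" and y: "y \<in> Y" for n m s y
  proof (induction m)
    case (Suc m)
    have "A n s (S z) = S (A n s z)" if "z \<in> Y" for z
      unfolding A_def Re using s that
      by (subst bounded_clinear_onD(3)[OF S])
        (auto simp: QS bounded_clinear_on_sum[OF Y S] intro: complex_vector.subspace_sum[OF Y])
    then show ?case using Suc y by simp
  qed simp
  \<comment> \<open>A move from s to s' starts from decay but ends only with boundedness by 1; decay
    returns at any strictly smaller radius, by comparison with a geometric sequence. Progress needs
    the move to exceed the retreat.\<close>
  define decays where
    "decays = (\<lambda>s. \<forall>e>0. \<exists>N. \<forall>n\<ge>N. \<forall>y\<in>Y. norm ((S ^^ n) y) * s ^ n \<le> e * norm y)"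
  define stays where
    "stays = (\<lambda>s. \<exists>N. \<forall>n\<ge>N. \<forall>y\<in>Y. norm ((S ^^ n) y) * s ^ n \<le> norm y)"
  \<comment> \<open>Moving s by \<delta> changes an average by at most \<open>norm y / 4\<close>.
    Decay contributes another quarter, so the averages at s' stay within one half of the
    identity.\<close>
  define \<delta> where "\<delta> = 1 / (4 * (C * B * C))"
  have \<delta>: "\<delta> > 0" "C * B * C * \<delta> = 1 / 4" using B C by (auto simp: \<delta>_def)
  have step: "stays s'" if "decays s" "0 \<le> s" "s \<le> \<rho>" "0 \<le> s'" "s' \<le> \<rho>" "\<bar>s' - s\<bar> \<le> \<delta>" for s s'
  proof -
    obtain N where N: "\<And>n y. n \<ge> N \<Longrightarrow> y \<in> Y \<Longrightarrow> norm ((S ^^ n) y) * s ^ n \<le> (1 / (4 * C)) * norm y"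
    proof -
      have "1 / (4 * C) > 0" using C(1) by simp
      then show ?thesis using that \<open>decays s\<close> unfolding decays_def by blast
    qed
    have close: "norm (A n s' y - y) \<le> norm y / 2" if n: "n \<ge> N" "n > 0" and y: "y \<in> Y" for n y
    proof -
      have "norm (A n s y - y) = norm (s ^ n *\<^sub>R (S ^^ n) (A n s y))"
        using Ainv[of s y n] n y \<open>0 \<le> s\<close> \<open>s \<le> \<rho>\<close> by (metis add_diff_cancel_left' diff_add_cancel)
      also have "\<dots> \<le> (1 / (4 * C)) * norm (A n s y)"
        using N[of n "A n s y"] n y \<open>0 \<le> s\<close> \<open>s \<le> \<rho>\<close> by (simp add: mult.commute)
      also have "\<dots> \<le> (1 / (4 * C)) * (C * norm y)"
        using C(1) n y \<open>0 \<le> s\<close> \<open>s \<le> \<rho>\<close> by (intro mult_left_mono An) auto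
      finally have 1: "norm (A n s y - y) \<le> norm y / 4" using C(1) by simp
      have "norm (A n s' y - A n s y) \<le> C * B * C * \<bar>s' - s\<bar> * norm y"
        using that \<open>0 \<le> s\<close> \<open>s \<le> \<rho>\<close> \<open>0 \<le> s'\<close> \<open>s' \<le> \<rho>\<close> by (intro Alip)
      also have "\<dots> \<le> C * B * C * \<delta> * norm y"
        using \<open>\<bar>s' - s\<bar> \<le> \<delta>\<close> B C by (intro mult_right_mono mult_left_mono) auto
      finally have 2: "norm (A n s' y - A n s y) \<le> norm y / 4" using \<delta> by simp
      have "A n s' y - y = (A n s' y - A n s y) + (A n s y - y)" by simp
      then show ?thesis using 1 2 norm_triangle_ineq[of "A n s' y - A n s y" "A n s y - y"] by simp
    qed
    have "norm ((S ^^ n) y) * s' ^ n \<le> norm y" if n: "n \<ge> Suc N" and y: "y \<in> Y" for n y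
    proof -
      \<comment> \<open>Write A for the average at s'. The inverse formula reads A w = A y - y, of
        norm at most half that of y, while A w differs from w by at most half the norm of w. Hence
        norm w \<le> norm y.\<close>
      define w where "w = s' ^ n *\<^sub>R (S ^^ n) y"
      have wY: "w \<in> Y" using y by (simp add: w_def Re)
      have "s' ^ n *\<^sub>R A n s' ((S ^^ n) y) = A n s' y - y"
        using Ainv[of s' y n] AS[of s' y n n] n y \<open>0 \<le> s'\<close> \<open>s' \<le> \<rho>\<close>
        by (metis Suc_le_lessD add_diff_cancel_left' diff_add_cancel not_less0 gr0I)
      moreover have "norm (A n s' ((S ^^ n) y) - (S ^^ n) y) \<le> norm ((S ^^ n) y) / 2"
        using n y by (intro close) auto
      then have "s' ^ n * norm (A n s' ((S ^^ n) y) - (S ^^ n) y) \<le> s' ^ n * (norm ((S ^^ n) y) / 2)"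
        using \<open>0 \<le> s'\<close> by (intro mult_left_mono) auto
      then have "norm (s' ^ n *\<^sub>R A n s' ((S ^^ n) y) - w) \<le> norm w / 2"
        using \<open>0 \<le> s'\<close> by (simp add: w_def flip: scaleR_diff_right)
      moreover have "norm (A n s' y - y) \<le> norm y / 2" using n y by (intro close) auto
      moreover have "norm w \<le> norm (A n s' y - y) + norm (A n s' y - y - w)"
        using norm_triangle_ineq4[of "A n s' y - y" "A n s' y - y - w"] by simp
      ultimately have "norm w \<le> norm y" by simp
      then show ?thesis using \<open>0 \<le> s'\<close> by (simp add: w_def mult.commute)
    qed
    then show ?thesis unfolding stays_def by blast
  qed
  have drop: "decays s" if "stays s'" "0 \<le> s" "s < s'" for s s'
    unfolding decays_def
  proof (intro allI impI)
    fix e :: real assume e: "e > 0"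
    obtain N where N: "\<And>n y. n \<ge> N \<Longrightarrow> y \<in> Y \<Longrightarrow> norm ((S ^^ n) y) * s' ^ n \<le> norm y"
      using \<open>stays s'\<close> unfolding stays_def by blast
    have "(\<lambda>n. (s / s') ^ n) \<longlonglongrightarrow> 0" using that by (intro LIMSEQ_realpow_zero) auto
    then have "\<forall>\<^sub>F n in sequentially. (s / s') ^ n < e" using e by (rule order_tendstoD)
    then obtain N' where N': "\<And>n. n \<ge> N' \<Longrightarrow> (s / s') ^ n < e"
      by (auto simp: eventually_sequentially)
    have "norm ((S ^^ n) y) * s ^ n \<le> e * norm y" if n: "n \<ge> max N N'" and y: "y \<in> Y" for n y
    proof -
      have "norm ((S ^^ n) y) * s ^ n = (s / s') ^ n * (norm ((S ^^ n) y) * s' ^ n)"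
        using \<open>0 \<le> s\<close> \<open>s < s'\<close> by (simp add: power_divide)
      also have "\<dots> \<le> e * norm y"
        using N[of n y] N'[of n] n y e \<open>0 \<le> s\<close> \<open>s < s'\<close> by (intro mult_mono) auto
      finally show ?thesis .
    qed
    then show "\<exists>N. \<forall>n\<ge>N. \<forall>y\<in>Y. norm ((S ^^ n) y) * s ^ n \<le> e * norm y" by blast
  qed
  \<comment> \<open>The mesh \<rho> / m is at most \<delta> / 2: each move advances two mesh widths
    and then gives one back to recover decay.\<close>
  obtain m :: nat where m: "m \<ge> 1" "2 * \<rho> \<le> m * \<delta>"
  proof -
    obtain m :: nat where "2 * \<rho> / \<delta> \<le> m" using real_arch_simple by blast
    then have "2 * \<rho> \<le> (m + 1) * \<delta>" using \<delta> by (simp add: field_simps)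
    then show ?thesis using that[of "m + 1"] by simp
  qed
  \<comment> \<open>The threshold is 1 because \<open>0 ^ 0 = 1\<close>.\<close>
  have zero: "decays 0"
    unfolding decays_def by (intro allI impI exI[of _ 1]) (auto simp: power_0_left)
  have "stays \<rho>"
  proof (cases "\<rho> = 0")
    case True
    then show ?thesis using step[OF zero, of 0] \<delta> by simp
  next
    case False
    with \<rho> have \<rho>: "\<rho> > 0" by simp
    have frac: "real i * \<rho> / m \<le> \<rho>" if "i \<le> m" for i
      using that m \<rho> by (simp add: field_simps)
    have dec: "decays (real k * \<rho> / m)" if "k < m" for k
      using that
    proof (induction k)
      case (Suc k)
      have "stays (real (Suc (Suc k)) * \<rho> / m)"
      proof (rule step[OF Suc.IH])
        have "real (Suc (Suc k)) * \<rho> / m - real k * \<rho> / m = 2 * \<rho> / m"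
          by (simp add: field_simps flip: diff_divide_distrib)
        then show "\<bar>real (Suc (Suc k)) * \<rho> / m - real k * \<rho> / m\<bar> \<le> \<delta>"
          using m \<rho> by (simp add: field_simps)
        show "real (Suc (Suc k)) * \<rho> / m \<le> \<rho>" "real k * \<rho> / m \<le> \<rho>"
          using Suc.prems by (intro frac; simp)+
      qed (use Suc.prems \<rho> in auto)
      then show ?case
        by (rule drop) (use m \<rho> in \<open>auto intro!: divide_strict_right_mono mult_strict_right_mono\<close>)
    qed (use zero in simp)
    \<comment> \<open>The last move covers one mesh width and ends exactly at \<rho>. Nothing beyond
      \<rho> is available to retreat from, so boundedness is all that remains there.\<close>
    have "decays (real (m - 1) * \<rho> / m)" using m by (intro dec) simp
    then show ?thesis
    proof (rule step)
      have "\<rho> - real (m - 1) * \<rho> / m = \<rho> / m" using m by (simp add: field_simps of_nat_diff)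
      then show "\<bar>\<rho> - real (m - 1) * \<rho> / m\<bar> \<le> \<delta>"
        using m \<rho> by (simp add: field_simps)
    qed (use \<rho> frac in auto)
  qed
  then obtain N where N: "\<And>n y. n \<ge> N \<Longrightarrow> y \<in> Y \<Longrightarrow> norm ((S ^^ n) y) * \<rho> ^ n \<le> norm y"
    unfolding stays_def by auto
  have "\<exists>b>0. \<forall>y\<in>Y. norm ((S ^^ n) y) \<le> b * norm y" for n
    using bounded_clinear_on_bound[OF bounded_clinear_on_funpow[OF S, of n]] by metis
  then obtain b where b: "\<And>n. b n > 0" "\<And>n y. y \<in> Y \<Longrightarrow> norm ((S ^^ n) y) \<le> b n * norm y"
    by metis
  define M where "M = 1 + (\<Sum>n<N. b n * \<rho> ^ n)"
  have nonneg: "0 \<le> b n * \<rho> ^ n" for n using b(1)[of n] \<rho> by simp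
  have M1: "M \<ge> 1" unfolding M_def using sum_nonneg[of "{..<N}" "\<lambda>n. b n * \<rho> ^ n"] nonneg by simp
  have "norm ((S ^^ n) y) * \<rho> ^ n \<le> M * norm y" if y: "y \<in> Y" for n y
  proof (cases "n < N")
    case True
    have "b n * \<rho> ^ n \<le> M"
      unfolding M_def using nonneg True by (intro add_increasing member_le_sum) auto
    then have "b n * \<rho> ^ n * norm y \<le> M * norm y" by (intro mult_right_mono) auto
    moreover have "norm ((S ^^ n) y) * \<rho> ^ n \<le> b n * norm y * \<rho> ^ n"
      using b(2)[OF y] \<rho> by (intro mult_right_mono) auto
    ultimately show ?thesis by (simp add: mult_ac)
  next
    case False
    then have "norm ((S ^^ n) y) * \<rho> ^ n \<le> 1 * norm y" using N y by simp
    also have "\<dots> \<le> M * norm y" using M1 by (intro mult_right_mono) auto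
    finally show ?thesis .
  qed
  then show ?thesis using that[of M] M1 by simp
qed


subsection \<open>Bounded decompositions\<close>

lemma Baire_closed_cover:
  fixes D :: "nat \<Rightarrow> 'a::{real_normed_vector,complete_space} set"
  assumes "(\<Union>n. D n) = UNIV" and "\<And>n. closed (D n)"
  obtains n x e where "e > 0" "ball x e \<subseteq> D n"
proof -
  have "\<exists>n. euclidean interior_of D n \<noteq> {}"
  proof (rule ccontr)
    assume "\<not> ?thesis"
    moreover have "Met_TC.mcomplete TYPE('a)"
      by (metis MCauchy_iff_Cauchy Met_TC.mcomplete_def Cauchy_convergent convergent_def limitin_iff_tendsto)
    ultimately have "Met_TC.mtopology interior_of \<Union>(range D) = {}"
      by (intro Met_TC.metric_Baire_category_alt) (auto simp: assms)
    then show False using assms(1) by simp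
  qed
  then obtain n x where "x \<in> euclidean interior_of D n" by auto
  then obtain S where S: "open S" "x \<in> S" "S \<subseteq> D n" by (auto simp: interior_of_def)
  then obtain e where "e > 0" "ball x e \<subseteq> S" by (meson open_contains_ball)
  with S that show ?thesis by blast
qed

lemma sums_in_closed_subspace:
  assumes "csubspace Y" "closed Y" "f sums s" "\<And>n. f n \<in> Y"
  shows "s \<in> Y"
proof (rule closed_sequentially[OF assms(2)])
  show "(\<Sum>i<n. f i) \<in> Y" for n
    by (intro complex_vector.subspace_sum assms(1,4))
  show "(\<lambda>n. \<Sum>i<n. f i) \<longlonglongrightarrow> s" using assms(3) by (simp add: sums_def)
qed

text \<open>The open mapping theorem for addition on Y \<times> Z. Baire gives approximate
  decompositions with controlled summands, and successive correction makes them exact.\<close>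

lemma bounded_decomposition:
  fixes Y Z :: "'a::complex_banach set"
  assumes Y: "csubspace Y" "closed Y" and Z: "csubspace Z" "closed Z"
    and sum: "{y + z | y z. y \<in> Y \<and> z \<in> Z} = UNIV"
  obtains C where "C > 0" "\<And>x. \<exists>y\<in>Y. x - y \<in> Z \<and> norm y \<le> C * norm x"
proof -
  define D where "D = (\<lambda>n::nat. {y + z | y z. y \<in> Y \<and> z \<in> Z \<and> norm y \<le> n \<and> norm z \<le> n})"
  have "(\<Union>n. closure (D n)) = UNIV"
  proof -
    have "x \<in> (\<Union>n. closure (D n))" for x
    proof -
      obtain y z where "x = y + z" "y \<in> Y" "z \<in> Z" using sum by blast
      moreover obtain n :: nat where "max (norm y) (norm z) \<le> n" using real_arch_simple by blast
      ultimately have "x \<in> D n" by (auto simp: D_def)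
      then show ?thesis using closure_subset by blast
    qed
    then show ?thesis by blast
  qed
  then obtain n x0 e where e: "e > 0" "ball x0 e \<subseteq> closure (D n)"
    using Baire_closed_cover[of "\<lambda>n. closure (D n)"] by (metis closed_closure)
  \<comment> \<open>Subtracting approximations of \<open>x0 + x\<close> and of \<open>x0\<close>
    moves the ball to the origin and doubles the bound n.\<close>
  have diff: "\<exists>y\<in>Y. \<exists>z\<in>Z. norm y \<le> 2 * n \<and> norm z \<le> 2 * n \<and> norm (x - (y + z)) < \<eta>"
    if x: "norm x < e" and "\<eta> > 0" for x \<eta>
  proof -
    have "x0 + x \<in> closure (D n)" "x0 \<in> closure (D n)"
      using e x by (auto simp: subset_eq dist_norm)
    then obtain d d' where d: "d \<in> D n" "dist d (x0 + x) < \<eta> / 2" and d': "d' \<in> D n" "dist d' x0 < \<eta> / 2"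
      using \<open>\<eta> > 0\<close> by (meson closure_approachable half_gt_zero)
    obtain y z y' z' where yz: "d = y + z" "y \<in> Y" "z \<in> Z" "norm y \<le> n" "norm z \<le> n"
      "d' = y' + z'" "y' \<in> Y" "z' \<in> Z" "norm y' \<le> n" "norm z' \<le> n"
      using d d' by (auto simp: D_def)
    have "norm (y - y') \<le> 2 * n" "norm (z - z') \<le> 2 * n"
      using norm_triangle_ineq4[of y y'] norm_triangle_ineq4[of z z'] yz by auto
    moreover have "x - ((y - y') + (z - z')) = (d' - x0) - (d - (x0 + x))" using yz by simp
    then have "norm (x - ((y - y') + (z - z'))) \<le> norm (d' - x0) + norm (d - (x0 + x))"
      by (metis norm_triangle_ineq4)
    then have "norm (x - ((y - y') + (z - z'))) < \<eta>" using d d' by (simp add: dist_norm)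
    moreover have "y - y' \<in> Y" "z - z' \<in> Z"
      using yz by (auto intro: complex_vector.subspace_diff Y Z)
    ultimately show ?thesis by blast
  qed
  \<comment> \<open>A nonzero x is scaled to norm e / 2; summands of norm at most 2 n then scale
    back to at most (4 n / e) times the norm of x.\<close>
  define K where "K = 4 * n / e"
  have K: "K \<ge> 0" using e by (simp add: K_def)
  have "\<exists>y z. y \<in> Y \<and> z \<in> Z \<and> norm y \<le> K * norm x \<and> norm z \<le> K * norm x \<and>
      norm (x - (y + z)) \<le> norm x / 2" for x
  proof (cases "x = 0")
    case True
    then show ?thesis by (intro exI[of _ 0]) (simp add: complex_vector.subspace_0 Y Z)
  next
    case False
    define t where "t = e / (2 * norm x)"
    have t: "t > 0" "norm (t *\<^sub>R x) < e" using False e by (auto simp: t_def)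
    then obtain y z where yz: "y \<in> Y" "z \<in> Z" "norm y \<le> 2 * n" "norm z \<le> 2 * n"
      "norm (t *\<^sub>R x - (y + z)) < t * norm x / 2"
      using diff[of "t *\<^sub>R x" "t * norm x / 2"] False by auto
    have Re: "r *\<^sub>R x = of_real r *\<^sub>C x" for r and x :: 'a by (simp add: scaleC_of_real)
    let ?y = "(1 / t) *\<^sub>R y" and ?z = "(1 / t) *\<^sub>R z"
    have tK: "2 * n / t = K * norm x" using e by (simp add: t_def K_def)
    have "norm ?y \<le> 2 * n / t" "norm ?z \<le> 2 * n / t"
      using t(1) yz by (auto simp: divide_right_mono)
    moreover have "x - (?y + ?z) = (1 / t) *\<^sub>R (t *\<^sub>R x - (y + z))"
      using t(1) by (simp add: scaleR_add_right scaleR_diff_right)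
    then have "norm (x - (?y + ?z)) = norm (t *\<^sub>R x - (y + z)) / t" using t(1) by simp
    then have "norm (x - (?y + ?z)) \<le> norm x / 2"
      using yz(5) t(1) by (simp only: pos_divide_le_eq) (simp add: mult.commute)
    moreover have "?y \<in> Y" "?z \<in> Z"
      unfolding Re using yz by (auto intro: complex_vector.subspace_scale Y Z)
    ultimately show ?thesis unfolding tK by blast
  qed
  then obtain p q where pq: "\<And>x. p x \<in> Y" "\<And>x. q x \<in> Z" "\<And>x. norm (p x) \<le> K * norm x"
    "\<And>x. norm (q x) \<le> K * norm x" "\<And>x. norm (x - (p x + q x)) \<le> norm x / 2"
    by metis
  have "\<exists>y\<in>Y. x - y \<in> Z \<and> norm y \<le> (2 * K + 1) * norm x" for x
  proof -
    \<comment> \<open>The residual after k corrections, at least halved each time. The corrections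
      in Y add up to norm at most 2 K times that of x; the extra 1 below keeps the constant positive
      when K = 0.\<close>
    define r where "r = (\<lambda>k. ((\<lambda>x. x - (p x + q x)) ^^ k) x)"
    have r_Suc: "r (Suc k) = r k - (p (r k) + q (r k))" for k by (simp add: r_def)
    have r: "norm (r k) \<le> (1 / 2) ^ k * norm x" for k
    proof (induction k)
      case (Suc k)
      then show ?case using pq(5)[of "r k"] by (simp add: r_Suc)
    qed (simp add: r_def)
    have geo: "summable (\<lambda>k. K * norm x * (1 / 2 :: real) ^ k)"
      by (intro summable_mult summable_geometric) simp
    have bnd: "norm (p (r k)) \<le> K * norm x * (1 / 2) ^ k" "norm (q (r k)) \<le> K * norm x * (1 / 2) ^ k" for k
      using pq(3)[of "r k"] pq(4)[of "r k"] mult_left_mono[OF r[of k] K] by (auto simp: mult_ac)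
    have sp: "summable (\<lambda>k. p (r k))" and sq: "summable (\<lambda>k. q (r k))"
      using bnd by (auto intro: summable_comparison_test'[OF geo])
    have "(\<lambda>k. r k - r (Suc k)) sums (r 0 - 0)"
    proof (rule telescope_sums')
      have "(\<lambda>k. (1 / 2) ^ k * norm x) \<longlonglongrightarrow> 0 * norm x"
        by (intro tendsto_mult_right LIMSEQ_power_zero) simp
      then show "r \<longlonglongrightarrow> 0"
        by (intro Lim_null_comparison[of r "\<lambda>k. (1 / 2) ^ k * norm x"]) (auto simp: r)
    qed
    moreover have "(\<lambda>k. r k - r (Suc k)) sums (suminf (\<lambda>k. p (r k)) + suminf (\<lambda>k. q (r k)))"
      using sums_add[OF summable_sums[OF sp] summable_sums[OF sq]] by (simp add: r_Suc add.commute)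
    ultimately have x: "x = suminf (\<lambda>k. p (r k)) + suminf (\<lambda>k. q (r k))"
      using sums_unique2 by (fastforce simp: r_def)
    have "suminf (\<lambda>k. p (r k)) \<in> Y" "suminf (\<lambda>k. q (r k)) \<in> Z"
      using sums_in_closed_subspace[OF Y summable_sums[OF sp]] pq
        sums_in_closed_subspace[OF Z summable_sums[OF sq]] by auto
    moreover have "norm (suminf (\<lambda>k. p (r k))) \<le> (2 * K + 1) * norm x"
    proof -
      have "norm (suminf (\<lambda>k. p (r k))) \<le> (\<Sum>k. K * norm x * (1 / 2) ^ k)"
        by (intro norm_suminf_le bnd geo)
      also have "\<dots> = 2 * K * norm x"
        by (subst suminf_mult) (auto simp: suminf_geometric summable_geometric)
      also have "\<dots> \<le> (2 * K + 1) * norm x" by (simp add: distrib_right)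
      finally show ?thesis .
    qed
    ultimately show ?thesis using x by (intro bexI[of _ "suminf (\<lambda>k. p (r k))"]) auto
  qed
  then show ?thesis using that[of "2 * K + 1"] K by simp
qed


subsection \<open>Local resolvents as power series\<close>

text \<open>On Y, T - (\<mu> + \<nu>) = (T - \<mu>) (1 - \<nu> R), so 1 - \<nu> R is invertible
  whenever \<mu> + \<nu> is in the resolvent set. Its inverse is both (T - \<mu>) R' and 1 + \<nu>
  R'; the first form gives surjectivity, the second the bound.\<close>

lemma resolvent_power_bound:
  assumes T: "bounded_clinear T" and Y: "csubspace Y" "T ` Y \<subseteq> Y"
    and \<rho>: "\<rho> \<ge> 0" and disj: "cball \<mu> \<rho> \<inter> spectrum_on Y T = {}"
  obtains R M where "bounded_clinear_on Y R" "\<And>y. y \<in> Y \<Longrightarrow> R (T y - \<mu> *\<^sub>C y) = y"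
    "\<And>y. y \<in> Y \<Longrightarrow> T (R y) - \<mu> *\<^sub>C R y = y"
    "M > 0" "\<And>n y. y \<in> Y \<Longrightarrow> norm ((R ^^ n) y) * \<rho> ^ n \<le> M * norm y"
proof -
  note [simp] = complex_vector.subspace_scale[OF Y(1)] complex_vector.subspace_diff[OF Y(1)]
    complex_vector.subspace_neg[OF Y(1)]
  have TY [simp]: "T y \<in> Y" if "y \<in> Y" for y using Y that by auto
  have "\<mu> \<in> cball \<mu> \<rho>" using \<rho> by simp
  then have \<mu>: "\<mu> \<notin> spectrum_on Y T" using disj by blast
  obtain R where R: "bounded_clinear_on Y R" "\<And>y. y \<in> Y \<Longrightarrow> R (T y - \<mu> *\<^sub>C y) = y"
    "\<And>y. y \<in> Y \<Longrightarrow> T (R y) - \<mu> *\<^sub>C R y = y"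
    by (rule notin_spectrum_onE[OF \<mu>], rule that)
  have res: "\<mu> + \<nu> \<notin> spectrum_on Y T" if "cmod \<nu> \<le> \<rho>" for \<nu>
  proof -
    have "\<mu> + \<nu> \<in> cball \<mu> \<rho>" using that by (simp add: dist_norm)
    then show ?thesis using disj by blast
  qed
  obtain M where M: "M > 0" "\<And>n y. y \<in> Y \<Longrightarrow> norm ((R ^^ n) y) * \<rho> ^ n \<le> M * norm y"
  proof (rule power_bound_of_invertible_pencil[OF Y(1) R(1) \<rho>])
    fix \<nu> :: complex and y assume \<nu>: "cmod \<nu> \<le> \<rho>" and y: "y \<in> Y"
    obtain R' where R': "bounded_clinear_on Y R'"
      "\<And>y. y \<in> Y \<Longrightarrow> R' (T y - (\<mu> + \<nu>) *\<^sub>C y) = y"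
      "\<And>y. y \<in> Y \<Longrightarrow> T (R' y) - (\<mu> + \<nu>) *\<^sub>C R' y = y"
      by (rule notin_spectrum_onE[OF res[OF \<nu>]], rule that)
    have R'y: "R' y \<in> Y" using bounded_clinear_onD(1)[OF R'(1) y] .
    show "\<exists>u\<in>Y. u - \<nu> *\<^sub>C R u = y"
    proof (rule bexI)
      show "(T (R' y) - \<mu> *\<^sub>C R' y) - \<nu> *\<^sub>C R (T (R' y) - \<mu> *\<^sub>C R' y) = y"
        using R'(3)[OF y] by (simp add: R(2)[OF R'y] complex_vector.scale_left_distrib diff_diff_eq)
    qed (use R'y in simp)
  next
    fix \<nu> :: complex assume \<nu>: "cmod \<nu> \<le> \<rho>"
    obtain R' where R': "bounded_clinear_on Y R'"
      "\<And>y. y \<in> Y \<Longrightarrow> R' (T y - (\<mu> + \<nu>) *\<^sub>C y) = y"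
      "\<And>y. y \<in> Y \<Longrightarrow> T (R' y) - (\<mu> + \<nu>) *\<^sub>C R' y = y"
      by (rule notin_spectrum_onE[OF res[OF \<nu>]], rule that)
    obtain b where b: "b > 0" "\<And>y. y \<in> Y \<Longrightarrow> norm (R' y) \<le> b * norm y"
      using bounded_clinear_on_bound[OF R'(1)] by blast
    have "norm u \<le> (1 + cmod \<nu> * b) * norm (u - \<nu> *\<^sub>C R u)" if u: "u \<in> Y" for u
    proof -
      have Ru: "R u \<in> Y" using bounded_clinear_onD(1)[OF R(1) u] .
      have "T (R u) - (\<mu> + \<nu>) *\<^sub>C R u = u - \<nu> *\<^sub>C R u"
        using R(3)[OF u] by (simp add: complex_vector.scale_left_distrib flip: diff_diff_eq)
      then have "R u = R' (u - \<nu> *\<^sub>C R u)" using R'(2)[OF Ru] by simp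
      then have 1: "norm (R u) \<le> b * norm (u - \<nu> *\<^sub>C R u)"
        using b(2)[of "u - \<nu> *\<^sub>C R u"] u Ru by simp
      have "norm u \<le> norm (u - \<nu> *\<^sub>C R u) + norm (\<nu> *\<^sub>C R u)"
        using norm_triangle_ineq[of "u - \<nu> *\<^sub>C R u" "\<nu> *\<^sub>C R u"] by simp
      then show ?thesis
        using mult_left_mono[OF 1, of "cmod \<nu>"] by (simp add: norm_scaleC algebra_simps)
    qed
    then show "\<exists>C. \<forall>u\<in>Y. norm u \<le> C * norm (u - \<nu> *\<^sub>C R u)" by blast
  qed blast
  show ?thesis by (rule that[OF R M])
qed

text \<open>With S = T - \<mu> one has T - (\<mu> + 1 / \<nu>) = -(1 / \<nu>) (1 - \<nu> S). For 0 <
  |\<nu>| \<le> 1 / \<rho> the point \<mu> + 1 / \<nu> lies outside the open disc containing the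
  spectrum; \<nu> = 0 is trivial.\<close>

lemma power_bound_of_spectrum:
  assumes T: "bounded_clinear T" and Y: "csubspace Y" "T ` Y \<subseteq> Y"
    and \<rho>: "\<rho> > 0" and sub: "spectrum_on Y T \<subseteq> ball \<mu> \<rho>"
  obtains M where "M > 0"
    "\<And>n y. y \<in> Y \<Longrightarrow> norm (((\<lambda>x. T x - \<mu> *\<^sub>C x) ^^ n) y) \<le> M * \<rho> ^ n * norm y"
proof -
  note [simp] = complex_vector.subspace_scale[OF Y(1)] complex_vector.subspace_diff[OF Y(1)]
    complex_vector.subspace_neg[OF Y(1)]
  have TY [simp]: "T y \<in> Y" if "y \<in> Y" for y using Y that by auto
  define S where "S = (\<lambda>x. T x - \<mu> *\<^sub>C x)"
  have S: "bounded_clinear_on Y S"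
    unfolding S_def by (intro bounded_clinear_on_subspace bounded_clinear_shift T) auto
  have res: "\<mu> + 1 / \<nu> \<notin> spectrum_on Y T" if "cmod \<nu> \<le> 1 / \<rho>" "\<nu> \<noteq> 0" for \<nu>
  proof -
    have "\<rho> \<le> 1 / cmod \<nu>" using that \<rho> by (simp add: field_simps)
    then show ?thesis using sub by (auto simp: dist_norm norm_divide)
  qed
  have eq: "T u - (\<mu> + 1 / \<nu>) *\<^sub>C u = (- 1 / \<nu>) *\<^sub>C (u - \<nu> *\<^sub>C S u)" if "\<nu> \<noteq> 0" for \<nu> u
    using that by (simp add: S_def complex_vector.scale_left_distrib
        complex_vector.scale_right_diff_distrib scaleC_one)
  obtain M where M: "M > 0" "\<And>n y. y \<in> Y \<Longrightarrow> norm ((S ^^ n) y) * (1 / \<rho>) ^ n \<le> M * norm y"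
  proof (rule power_bound_of_invertible_pencil[OF Y(1) S])
    show "1 / \<rho> \<ge> 0" using \<rho> by simp
  next
    fix \<nu> :: complex and y assume \<nu>: "cmod \<nu> \<le> 1 / \<rho>" and y: "y \<in> Y"
    show "\<exists>u\<in>Y. u - \<nu> *\<^sub>C S u = y"
    proof (cases "\<nu> = 0")
      case False
      obtain R where R: "bounded_clinear_on Y R"
        "\<And>y. y \<in> Y \<Longrightarrow> R (T y - (\<mu> + 1 / \<nu>) *\<^sub>C y) = y"
        "\<And>y. y \<in> Y \<Longrightarrow> T (R y) - (\<mu> + 1 / \<nu>) *\<^sub>C R y = y"
        by (rule notin_spectrum_onE[OF res[OF \<nu> False]], rule that)
      define v where "v = (- 1 / \<nu>) *\<^sub>C y"
      have v: "v \<in> Y" unfolding v_def using y by (rule complex_vector.subspace_scale[OF Y(1)])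
      have "(- 1 / \<nu>) *\<^sub>C (R v - \<nu> *\<^sub>C S (R v)) = (- 1 / \<nu>) *\<^sub>C y"
        using eq[OF False, of "R v"] R(3)[OF v] by (simp only: v_def)
      then have "R v - \<nu> *\<^sub>C S (R v) = y"
        using False by (subst (asm) complex_vector.scale_cancel_left) simp
      moreover have "R v \<in> Y" using bounded_clinear_onD(1)[OF R(1) v] .
      ultimately show ?thesis by blast
    qed (use y in auto)
  next
    fix \<nu> :: complex assume \<nu>: "cmod \<nu> \<le> 1 / \<rho>"
    show "\<exists>C. \<forall>u\<in>Y. norm u \<le> C * norm (u - \<nu> *\<^sub>C S u)"
    proof (cases "\<nu> = 0")
      case False
      obtain R where R: "bounded_clinear_on Y R"
        "\<And>y. y \<in> Y \<Longrightarrow> R (T y - (\<mu> + 1 / \<nu>) *\<^sub>C y) = y"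
        "\<And>y. y \<in> Y \<Longrightarrow> T (R y) - (\<mu> + 1 / \<nu>) *\<^sub>C R y = y"
        by (rule notin_spectrum_onE[OF res[OF \<nu> False]], rule that)
      obtain b where b: "b > 0" "\<And>y. y \<in> Y \<Longrightarrow> norm (R y) \<le> b * norm y"
        using bounded_clinear_on_bound[OF R(1)] by blast
      have "norm u \<le> b / cmod \<nu> * norm (u - \<nu> *\<^sub>C S u)" if u: "u \<in> Y" for u
      proof -
        have Su: "S u \<in> Y" using bounded_clinear_onD(1)[OF S u] .
        have "u = R ((- 1 / \<nu>) *\<^sub>C (u - \<nu> *\<^sub>C S u))" using R(2)[OF u] eq[OF False] by simp
        then have "norm u \<le> b * norm ((- 1 / \<nu>) *\<^sub>C (u - \<nu> *\<^sub>C S u))"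
          using b(2)[of "(- 1 / \<nu>) *\<^sub>C (u - \<nu> *\<^sub>C S u)"] u Su by simp
        then show ?thesis by (simp add: norm_scaleC norm_divide)
      qed
      then show ?thesis by blast
    qed (auto intro: exI[of _ 1])
  qed blast
  show ?thesis
  proof (rule that[OF M(1)])
    show "norm (((\<lambda>x. T x - \<mu> *\<^sub>C x) ^^ n) y) \<le> M * \<rho> ^ n * norm y" if "y \<in> Y" for n y
      using M(2)[OF that, of n] \<rho> by (simp add: S_def[symmetric] field_simps)
  qed
qed

text \<open>
  The sequence \<open>a\<close> lists the coefficients of a power series \<open>f\<close> around \<open>\<mu>\<close>, of radius at least
  \<open>r\<close>, with \<open>(T - \<lambda>) (f \<lambda>) = x\<close>. Working with coefficients avoids vector-valued analytic functions.
\<close>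

definition taylor_solution ::
    "('a::complex_banach \<Rightarrow> 'a) \<Rightarrow> complex \<Rightarrow> real \<Rightarrow> 'a \<Rightarrow> (nat \<Rightarrow> 'a) \<Rightarrow> bool"
  where "taylor_solution T \<mu> r x a \<longleftrightarrow> T (a 0) - \<mu> *\<^sub>C a 0 = x \<and>
    (\<forall>k. T (a (Suc k)) - \<mu> *\<^sub>C a (Suc k) = a k) \<and> (\<exists>B. \<forall>k. norm (a k) * r ^ k \<le> B)"

lemma taylor_solutionE:
  assumes "taylor_solution T \<mu> r x a"
  obtains B where "T (a 0) - \<mu> *\<^sub>C a 0 = x" "\<And>k. T (a (Suc k)) - \<mu> *\<^sub>C a (Suc k) = a k"
    "\<And>k. norm (a k) * r ^ k \<le> B"
  using assms unfolding taylor_solution_def by metis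

lemma taylor_solution_mono:
  assumes "taylor_solution T \<mu> r x a" "0 \<le> r'" "r' \<le> r"
  shows "taylor_solution T \<mu> r' x a"
proof -
  obtain B where B: "\<And>k. norm (a k) * r ^ k \<le> B" using assms by (auto simp: taylor_solution_def)
  have "norm (a k) * r' ^ k \<le> B" for k
    using mult_left_mono[OF power_mono[OF assms(3,2), of k], of "norm (a k)"] B[of k] by simp
  then show ?thesis using assms by (auto simp: taylor_solution_def)
qed

lemma taylor_solution_commuting:
  assumes T: "bounded_clinear T" and A: "bounded_clinear A" and AT: "\<And>x. A (T x) = T (A x)"
    and a: "taylor_solution T \<mu> r x a" and r: "r \<ge> 0"
  shows "taylor_solution T \<mu> r (A x) (\<lambda>k. A (a k))"
proof -
  obtain B where B: "\<And>k. norm (a k) * r ^ k \<le> B" using a by (auto simp: taylor_solution_def)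
  obtain c where c: "c > 0" "\<And>x. norm (A x) \<le> c * norm x" using bounded_clinear_bound[OF A] by blast
  have "norm (A (a k)) * r ^ k \<le> c * B" for k
  proof -
    have "norm (A (a k)) * r ^ k \<le> (c * norm (a k)) * r ^ k"
      using c r by (intro mult_right_mono) auto
    also have "\<dots> \<le> c * B" using B[of k] c(1) by (simp add: mult.assoc mult_left_mono)
    finally show ?thesis .
  qed
  moreover have "T (A y) - \<mu> *\<^sub>C A y = A (T y - \<mu> *\<^sub>C y)" for y
    by (simp add: AT bounded_clinear_simps[OF A])
  ultimately show ?thesis using a by (auto simp: taylor_solution_def)
qed

lemma taylor_solution_add:
  assumes T: "bounded_clinear T" and r: "r \<ge> 0"
    and a: "taylor_solution T \<mu> r x a" and b: "taylor_solution T \<mu> r y b"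
  shows "taylor_solution T \<mu> r (x + y) (\<lambda>k. a k + b k)"
proof -
  obtain A where A: "\<And>k. norm (a k) * r ^ k \<le> A" by (rule taylor_solutionE[OF a], rule that)
  obtain B where B: "\<And>k. norm (b k) * r ^ k \<le> B" by (rule taylor_solutionE[OF b], rule that)
  have "norm (a k + b k) * r ^ k \<le> A + B" for k
    using mult_right_mono[OF norm_triangle_ineq[of "a k" "b k"], of "r ^ k"] A[of k] B[of k] r
    by (simp add: distrib_right)
  moreover have "T (u + v) - \<mu> *\<^sub>C (u + v) = (T u - \<mu> *\<^sub>C u) + (T v - \<mu> *\<^sub>C v)" for u v
    by (rule bounded_clinear_simps(1)[OF bounded_clinear_shift[OF T]])
  ultimately show ?thesis
    using a b unfolding taylor_solution_def by auto
qed

lemma taylor_solution_scale: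
  assumes "bounded_clinear T" "taylor_solution T \<mu> r x a" "r \<ge> 0"
  shows "taylor_solution T \<mu> r (c *\<^sub>C x) (\<lambda>k. c *\<^sub>C a k)"
  by (rule taylor_solution_commuting[OF assms(1) bounded_clinear_scaleC_id _ assms(2,3)])
    (simp add: bounded_clinear_scaleC[OF assms(1)])

lemma taylor_solution_diff:
  assumes "bounded_clinear T" "r \<ge> 0" "taylor_solution T \<mu> r x a" "taylor_solution T \<mu> r y b"
  shows "taylor_solution T \<mu> r (x - y) (\<lambda>k. a k - b k)"
  using taylor_solution_add[OF assms(1,2,3) taylor_solution_scale[OF assms(1,4,2), of "- 1"]]
  by (simp add: complex_vector.scale_minus_left scaleC_one)

text \<open>
  Quantitative Bishop property: decompose \<open>X = Y + Z\<close> with the spectrum on \<open>Y\<close> in a disc of radius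
  between \<open>r\<^sub>1\<close> and \<open>r\<close> and the spectrum on \<open>Z\<close> outside the disc of radius \<open>r\<^sub>1\<close>. The coefficients
  lie in \<open>Z\<close>, because \<open>a k = (T - \<mu>) ^ n (a (k + n))\<close> and \<open>(T - \<mu>) ^ n\<close> shrinks the \<open>Y\<close>-part of
  \<open>a (k + n)\<close>, so that they are given by the resolvent of \<open>T\<close> on \<open>Z\<close>.
\<close>

lemma taylor_solution_bound:
  assumes T: "decomposable T" and r: "0 < r\<^sub>1" "r\<^sub>1 < r"
  obtains C where "C > 0"
    "\<And>x a k. taylor_solution T \<mu> r x a \<Longrightarrow> norm (a k) * r\<^sub>1 ^ k \<le> C * norm x"
proof -
  have Tl: "bounded_clinear T" using T by (simp add: decomposable_def)
  define r\<^sub>2 where "r\<^sub>2 = (r\<^sub>1 + r) / 2"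
  have r2: "r\<^sub>1 < r\<^sub>2" "r\<^sub>2 < r" "0 < r\<^sub>2" using r by (auto simp: r\<^sub>2_def)
  have "ball \<mu> r\<^sub>2 \<union> - cball \<mu> r\<^sub>1 = UNIV" using r2 by auto
  then obtain Y Z where Y: "closed_invariant_subspace T Y" and Z: "closed_invariant_subspace T Z"
    and YZ: "{y + z | y z. y \<in> Y \<and> z \<in> Z} = UNIV"
    and spec: "spectrum_on Y T \<subseteq> ball \<mu> r\<^sub>2" "spectrum_on Z T \<subseteq> - cball \<mu> r\<^sub>1"
    using T unfolding decomposable_def
    by (elim conjE allE[of _ "ball \<mu> r\<^sub>2"] allE[of _ "- cball \<mu> r\<^sub>1"]) (auto simp: closed_Compl)
  have Y': "csubspace Y" "closed Y" "T ` Y \<subseteq> Y" and Z': "csubspace Z" "closed Z" "T ` Z \<subseteq> Z"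
    using Y Z by (auto simp: closed_invariant_subspace_def)
  define S where "S = (\<lambda>x. T x - \<mu> *\<^sub>C x)"
  have Sn: "bounded_clinear (S ^^ n)" for n
    unfolding S_def by (intro bounded_clinear_funpow bounded_clinear_shift Tl)
  have SZ: "S z \<in> Z" if "z \<in> Z" for z
    unfolding S_def using Z' that
    by (auto intro!: complex_vector.subspace_diff complex_vector.subspace_scale)
  have SnZ: "(S ^^ n) z \<in> Z" if "z \<in> Z" for n z using that SZ by (induction n) auto
  obtain C where C: "C > 0" "\<And>x. \<exists>y\<in>Y. x - y \<in> Z \<and> norm y \<le> C * norm x"
    using bounded_decomposition[OF Y'(1,2) Z'(1,2) YZ] by blast
  then obtain p where p: "\<And>x. p x \<in> Y" "\<And>x. x - p x \<in> Z" "\<And>x. norm (p x) \<le> C * norm x"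
    by metis
  obtain M where M: "M > 0" "\<And>n y. y \<in> Y \<Longrightarrow> norm ((S ^^ n) y) \<le> M * r\<^sub>2 ^ n * norm y"
    using power_bound_of_spectrum[OF Tl Y'(1,3) r2(3) spec(1), folded S_def] by blast
  have disj: "cball \<mu> r\<^sub>1 \<inter> spectrum_on Z T = {}" using spec by auto
  obtain R M' where "bounded_clinear_on Z R"
    and R: "\<And>y. y \<in> Z \<Longrightarrow> R (T y - \<mu> *\<^sub>C y) = y"
    and "\<And>y. y \<in> Z \<Longrightarrow> T (R y) - \<mu> *\<^sub>C R y = y"
    and M': "M' > 0" "\<And>n y. y \<in> Z \<Longrightarrow> norm ((R ^^ n) y) * r\<^sub>1 ^ n \<le> M' * norm y"
    by (rule resolvent_power_bound[OF Tl Z'(1,3) less_imp_le[OF r(1)] disj], rule that)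
  have "norm (a k) * r\<^sub>1 ^ k \<le> M' / r\<^sub>1 * norm x" if a: "taylor_solution T \<mu> r x a" for x a k
  proof -
    \<comment> \<open>This bound depends on \<open>a\<close>, but it serves only to place the
      coefficients in Z. The final constant comes from the resolvent on Z and is uniform in
      \<open>a\<close> and x.\<close>
    obtain B where B: "\<And>k. norm (a k) * r ^ k \<le> B" using a by (auto simp: taylor_solution_def)
    have S0: "S (a 0) = x" and SS: "S (a (Suc k)) = a k" for k
      using a by (auto simp: taylor_solution_def S_def)
    have shift: "(S ^^ n) (a (k + n)) = a k" for k n
    proof (induction n)
      case (Suc n)
      have "(S ^^ Suc n) (a (k + Suc n)) = (S ^^ n) (S (a (Suc (k + n))))"
        unfolding funpow_Suc_right by simp
      then show ?case using Suc by (simp only: SS)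
    qed simp
    have aZ: "a k \<in> Z" for k
    proof -
      define y where "y = (\<lambda>n. p (a (k + n)))"
      have y: "\<And>n. y n \<in> Y" "\<And>n. a (k + n) - y n \<in> Z"
        "\<And>n. norm (y n) \<le> C * norm (a (k + n))"
        by (simp_all add: y_def p)
      \<comment> \<open>The Y-part of \<open>a (k + n)\<close> is of order
        \<open>r ^ -(k + n)\<close>, while \<open>S ^^ n\<close> on Y is of order
        \<open>r\<^sub>2 ^ n\<close>; the ratio \<open>r\<^sub>2 / r\<close> is below 1.\<close>
      have small: "norm ((S ^^ n) (y n)) \<le> M * C * B / r ^ k * (r\<^sub>2 / r) ^ n" for n
      proof -
        have "norm (a (k + n)) \<le> B / r ^ (k + n)"
          using B[of "k + n"] r by (simp add: pos_le_divide_eq)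
        then have "C * norm (a (k + n)) \<le> C * (B / r ^ (k + n))"
          using C(1) by (intro mult_left_mono) auto
        then have "norm (y n) \<le> C * (B / r ^ (k + n))" using y(3)[of n] by linarith
        then have "M * r\<^sub>2 ^ n * norm (y n) \<le> M * r\<^sub>2 ^ n * (C * (B / r ^ (k + n)))"
          using M r r2 by (intro mult_left_mono) auto
        then have "norm ((S ^^ n) (y n)) \<le> M * r\<^sub>2 ^ n * (C * (B / r ^ (k + n)))"
          using M(2)[OF y(1)[of n], of n] by linarith
        then show ?thesis by (simp add: power_add power_divide mult_ac)
      qed
      have "(\<lambda>n. M * C * B / r ^ k * (r\<^sub>2 / r) ^ n) \<longlonglongrightarrow> M * C * B / r ^ k * 0"
        using r r2 by (intro tendsto_mult_left LIMSEQ_realpow_zero) auto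
      then have "(\<lambda>n. (S ^^ n) (y n)) \<longlonglongrightarrow> 0"
        by (intro Lim_null_comparison[OF always_eventually[OF allI[OF small]]]) simp
      then have "(\<lambda>n. a k - (S ^^ n) (y n)) \<longlonglongrightarrow> a k - 0" by (intro tendsto_diff) auto
      moreover have "a k - (S ^^ n) (y n) = (S ^^ n) (a (k + n) - y n)" for n
        by (simp add: bounded_clinear_simps[OF Sn] shift)
      ultimately show ?thesis
        using closed_sequentially[OF Z'(2), of "\<lambda>n. (S ^^ n) (a (k + n) - y n)" "a k"] y(2) SnZ by simp
    qed
    have xZ: "x \<in> Z" using SZ[OF aZ[of 0]] S0 by simp
    \<comment> \<open>Already the zeroth coefficient is \<open>R x\<close>. The shift by one is what
      divides the constant by \<open>r\<^sub>1\<close>.\<close>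
    have "a k = (R ^^ Suc k) x" for k
    proof (induction k)
      case 0
      then show ?case using R[OF aZ[of 0]] S0 by (simp add: S_def)
    next
      case (Suc k)
      then show ?case using R[OF aZ[of "Suc k"]] SS[of k] by (simp add: S_def)
    qed
    then have "norm (a k) * r\<^sub>1 ^ k * r\<^sub>1 \<le> M' * norm x"
      using M'(2)[OF xZ, of "Suc k"] by (simp add: mult_ac)
    then show ?thesis using r by (simp add: field_simps)
  qed
  then show ?thesis using that[of "M' / r\<^sub>1"] M' r by simp
qed

text \<open>The single-valued extension property: the difference solves the equation with right-hand
  side 0 on the smaller disc, and the Bishop bound is a multiple of the norm of the right-hand
  side.\<close>

lemma taylor_solution_unique:
  assumes T: "decomposable T" and r: "0 < r" "0 < r'"
    and a: "taylor_solution T \<mu> r x a" and b: "taylor_solution T \<mu> r' x b"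
  shows "a = b"
proof
  fix k
  have Tl: "bounded_clinear T" using T by (simp add: decomposable_def)
  define q where "q = min r r'"
  have q: "q > 0" using r by (simp add: q_def)
  have "taylor_solution T \<mu> q x a" "taylor_solution T \<mu> q x b"
    using taylor_solution_mono[OF a, of q] taylor_solution_mono[OF b, of q] q by (auto simp: q_def)
  then have d: "taylor_solution T \<mu> q 0 (\<lambda>k. a k - b k)"
    using taylor_solution_diff[OF Tl less_imp_le[OF q]] by fastforce
  have half: "0 < q / 2" "q / 2 < q" using q by auto
  obtain C where "C > 0"
    and C: "\<And>x a k. taylor_solution T \<mu> q x a \<Longrightarrow> norm (a k) * (q / 2) ^ k \<le> C * norm x"
    by (rule taylor_solution_bound[OF T half], rule that)
  from C[OF d, of k] have "norm (a k - b k) * (q / 2) ^ k \<le> 0" by simp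
  moreover have "(q / 2) ^ k > 0" using q by simp
  ultimately have "norm (a k - b k) \<le> 0" by (smt (verit) mult_pos_pos)
  then show "a k = b k" by simp
qed

text \<open>
  If \<open>b\<close> lists the coefficients of \<open>f\<close>, then \<open>y\<close> is the value of \<open>f\<close> at \<open>\<mu> + d\<close> and \<open>g\<close> lists the
  coefficients of the difference quotient \<open>(f \<lambda> - y) / (\<lambda> - \<mu> - d)\<close>.
\<close>

lemma taylor_solution_value:
  assumes T: "bounded_clinear T" and d: "cmod d < r"
    and b: "T (b 0) - \<mu> *\<^sub>C b 0 = x" "\<And>k. T (b (Suc k)) - \<mu> *\<^sub>C b (Suc k) = b k"
    and N: "\<And>k. norm (b k) * r ^ k \<le> N"
  obtains y g where "T y - (\<mu> + d) *\<^sub>C y = x" "norm y \<le> N * r / (r - cmod d)"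
    "T (g 0) - \<mu> *\<^sub>C g 0 = y" "\<And>k. T (g (Suc k)) - \<mu> *\<^sub>C g (Suc k) = g k"
    "\<And>k. norm (g k) * r ^ k \<le> N / (r - cmod d)"
proof -
  have r: "r > 0" using d norm_ge_zero[of d] by linarith
  define S where "S = (\<lambda>x. T x - \<mu> *\<^sub>C x)"
  have S: "bounded_clinear S" unfolding S_def by (rule bounded_clinear_shift[OF T])
  have S0: "S (b 0) = x" and SS: "S (b (Suc k)) = b k" for k using b by (simp_all add: S_def)
  have Ssums: "(\<lambda>j. S (f j)) sums S s" if "f sums s" for f s
    using S that by (auto simp: bounded_clinear_def intro: bounded_linear.sums)
  have bnd: "norm (d ^ j *\<^sub>C b (m + j)) \<le> N / r ^ m * (cmod d / r) ^ j" for m j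
  proof -
    have "norm (b (m + j)) \<le> N / r ^ (m + j)"
      using N[of "m + j"] r by (simp add: pos_le_divide_eq)
    then have "cmod d ^ j * norm (b (m + j)) \<le> cmod d ^ j * (N / r ^ (m + j))"
      by (intro mult_left_mono) auto
    then show ?thesis by (simp add: norm_scaleC norm_power power_add power_divide mult_ac)
  qed
  have q: "norm (cmod d / r) < 1" using d r by (simp add: norm_divide divide_less_eq)
  have geo: "summable (\<lambda>j. N / r ^ m * (cmod d / r) ^ j)" for m
    by (intro summable_mult summable_geometric q)
  have sm: "summable (\<lambda>j. d ^ j *\<^sub>C b (m + j))" for m
    by (rule summable_comparison_test'[OF geo[of m]]) (rule bnd)
  \<comment> \<open>Dividing the series by \<lambda> - \<mu> - d produces tail sums:
    \<open>h 0\<close> is the value at \<mu> + d and \<open>h (Suc m)\<close> is coefficient m of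
    the difference quotient. The relation \<open>h 0 = b 0 + d *\<^sub>C h 1\<close> then yields the
    equation at \<mu> + d.\<close>
  define h where "h = (\<lambda>m. \<Sum>j. d ^ j *\<^sub>C b (m + j))"
  have h: "(\<lambda>j. d ^ j *\<^sub>C b (m + j)) sums h m" for m
    unfolding h_def by (rule summable_sums[OF sm])
  have hn: "norm (h m) * r ^ m \<le> N * r / (r - cmod d)" for m
  proof -
    have "norm (h m) \<le> (\<Sum>j. N / r ^ m * (cmod d / r) ^ j)"
      unfolding h_def by (intro norm_suminf_le bnd geo)
    also have "\<dots> = N / r ^ m * (1 / (1 - cmod d / r))"
      using suminf_mult[OF summable_geometric[OF q], of "N / r ^ m"] suminf_geometric[OF q] by simp
    also have "1 / (1 - cmod d / r) = r / (r - cmod d)" using d r by (simp add: field_simps)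
    finally have "norm (h m) * r ^ m \<le> N / r ^ m * (r / (r - cmod d)) * r ^ m"
      using r by (intro mult_right_mono) auto
    then show ?thesis using r by simp
  qed
  have Sh: "S (h (Suc m)) = h m" for m
  proof -
    have "(\<lambda>j. S (d ^ j *\<^sub>C b (Suc m + j))) sums S (h (Suc m))" by (rule Ssums[OF h])
    then have "(\<lambda>j. d ^ j *\<^sub>C b (m + j)) sums S (h (Suc m))"
      by (simp add: bounded_clinear_scaleC[OF S] SS)
    then show ?thesis using h[of m] by (rule sums_unique2)
  qed
  have h0: "h 0 = b 0 + d *\<^sub>C h 1"
  proof -
    have "(\<lambda>j. d *\<^sub>C (d ^ j *\<^sub>C b (1 + j))) sums (d *\<^sub>C h 1)"
      using bounded_linear.sums[OF bounded_linear_scaleC_right h[of 1]] .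
    then have "(\<lambda>j. d ^ Suc j *\<^sub>C b (0 + Suc j)) sums (d *\<^sub>C h 1)" by simp
    moreover have "(\<lambda>j. d ^ Suc j *\<^sub>C b (0 + Suc j)) sums (h 0 - d ^ 0 *\<^sub>C b (0 + 0))"
      using h[of 0] by (subst sums_Suc_iff) simp
    ultimately have "d *\<^sub>C h 1 = h 0 - d ^ 0 *\<^sub>C b (0 + 0)" by (rule sums_unique2)
    then show ?thesis by (simp add: scaleC_one)
  qed
  have Sval: "S (h 0) = x + d *\<^sub>C h 0"
    using Sh[of 0] by (subst h0) (simp add: bounded_clinear_simps[OF S] S0)
  show ?thesis
  proof (rule that[of "h 0" "\<lambda>k. h (Suc k)"])
    show "T (h 0) - (\<mu> + d) *\<^sub>C h 0 = x"
      using Sval by (simp add: S_def complex_vector.scale_left_distrib algebra_simps)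
    show "norm (h 0) \<le> N * r / (r - cmod d)" using hn[of 0] by simp
    show "T (h (Suc 0)) - \<mu> *\<^sub>C h (Suc 0) = h 0" using Sh[of 0] by (simp add: S_def)
    show "T (h (Suc (Suc k))) - \<mu> *\<^sub>C h (Suc (Suc k)) = h (Suc k)" for k
      using Sh[of "Suc k"] by (simp add: S_def)
    show "norm (h (Suc k)) * r ^ k \<le> N / (r - cmod d)" for k
    proof -
      have "norm (h (Suc k)) * r ^ k * r \<le> N / (r - cmod d) * r" using hn[of "Suc k"] by (simp add: mult_ac)
      then show ?thesis using r by (rule mult_right_le_imp_le)
    qed
  qed
qed

text \<open>
  Analytic continuation: the coefficients around another centre \<open>\<kappa>\<close> are found by iterating the
  previous lemma, which divides the norm bound by \<open>r - \<bar>\<kappa> - \<mu>\<bar>\<close> at each step.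
\<close>

lemma taylor_solution_recentre:
  assumes T: "bounded_clinear T" and b: "taylor_solution T \<mu> r x b" and d: "dist \<mu> \<kappa> < r"
  obtains c g where "taylor_solution T \<kappa> (r - dist \<mu> \<kappa>) x c" "taylor_solution T \<mu> r (c 0) g"
proof -
  obtain N where b: "T (b 0) - \<mu> *\<^sub>C b 0 = x" "\<And>k. T (b (Suc k)) - \<mu> *\<^sub>C b (Suc k) = b k"
    and N: "\<And>k. norm (b k) * r ^ k \<le> N"
    by (rule taylor_solutionE[OF b], rule that)
  define q where "q = r - dist \<mu> \<kappa>"
  have q: "q > 0" using d by (simp add: q_def)
  define d where "d = \<kappa> - \<mu>"
  have d: "cmod d < r" "r - cmod d = q" "\<mu> + d = \<kappa>"
    using assms(3) by (auto simp: d_def q_def dist_norm norm_minus_commute)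
  \<comment> \<open>\<open>fst p\<close> is coefficient n around \<kappa>; \<open>snd p\<close> is a
    solution around \<mu> for that vector, and its value at \<kappa> will be the next coefficient.
    The powers of q give radius q at \<kappa>.\<close>
  define good where "good = (\<lambda>n p. T (snd p 0) - \<mu> *\<^sub>C snd p 0 = fst p \<and>
    (\<forall>k. T (snd p (Suc k)) - \<mu> *\<^sub>C snd p (Suc k) = snd p k) \<and>
    (\<forall>k. norm (snd p k) * r ^ k \<le> N / q ^ Suc n) \<and> norm (fst p) \<le> N * r / q ^ Suc n)"
  have step: "\<exists>p'. good (Suc n) p' \<and> T (fst p') - \<kappa> *\<^sub>C fst p' = fst p" if p: "good n p" for n p
  proof -
    obtain y g where "T y - (\<mu> + d) *\<^sub>C y = fst p" "norm y \<le> N / q ^ Suc n * r / (r - cmod d)"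
      "T (g 0) - \<mu> *\<^sub>C g 0 = y" "\<And>k. T (g (Suc k)) - \<mu> *\<^sub>C g (Suc k) = g k"
      "\<And>k. norm (g k) * r ^ k \<le> N / q ^ Suc n / (r - cmod d)"
      by (rule taylor_solution_value[OF T d(1), of "snd p" \<mu> "fst p" "N / q ^ Suc n"])
        (use p in \<open>auto simp: good_def\<close>)
    then show ?thesis
      unfolding d by (intro exI[of _ "(y, g)"]) (auto simp: good_def mult_ac)
  qed
  obtain y g where yg: "T y - \<kappa> *\<^sub>C y = x" "norm y \<le> N * r / q"
      "T (g 0) - \<mu> *\<^sub>C g 0 = y" "\<And>k. T (g (Suc k)) - \<mu> *\<^sub>C g (Suc k) = g k"
      "\<And>k. norm (g k) * r ^ k \<le> N / q"
    using taylor_solution_value[OF T d(1), of b \<mu> x N, OF b N] unfolding d by metis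
  have start: "good 0 (y, g)" using yg by (simp add: good_def)
  \<comment> \<open>The clause for n = 0 pins the start of the chosen sequence, so that
    \<open>g\<close> is known to be a solution for its first coefficient.\<close>
  obtain p where p: "p 0 = (y, g)" "\<And>n. good n (p n)" "\<And>n. T (fst (p (Suc n))) - \<kappa> *\<^sub>C fst (p (Suc n)) = fst (p n)"
    using dependent_nat_choice[of "\<lambda>n p. good n p \<and> (n = 0 \<longrightarrow> p = (y, g))"
        "\<lambda>n p p'. T (fst p') - \<kappa> *\<^sub>C fst p' = fst p"] start step
    by (metis nat.distinct(1))
  show thesis
  proof (rule that)
    show "taylor_solution T \<mu> r (fst (p 0)) g"
      using yg p(1) by (auto simp: taylor_solution_def)
    have "norm (fst (p k)) * q ^ k \<le> N * r / q" for k
    proof -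
      have "norm (fst (p k)) \<le> N * r / q / q ^ k" using p(2)[of k] by (simp add: good_def)
      then show ?thesis using q by (simp only: pos_le_divide_eq zero_less_power)
    qed
    then show "taylor_solution T \<kappa> (r - dist \<mu> \<kappa>) x (\<lambda>k. fst (p k))"
      using p yg(1) by (auto simp: taylor_solution_def q_def)
  qed
qed

section \<open>Local spectral subspaces\<close>

text \<open>Usually written \<open>X\<^sub>T(F)\<close>.\<close>

definition local_spectral_subspace :: "('a::complex_banach \<Rightarrow> 'a) \<Rightarrow> complex set \<Rightarrow> 'a set"
  where "local_spectral_subspace T F =
    {x. \<forall>\<mu> r. 0 < r \<longrightarrow> cball \<mu> r \<inter> F = {} \<longrightarrow> (\<exists>a. taylor_solution T \<mu> r x a)}"

lemma local_spectral_subspaceI: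
  assumes "\<And>\<mu> r. 0 < r \<Longrightarrow> cball \<mu> r \<inter> F = {} \<Longrightarrow> \<exists>a. taylor_solution T \<mu> r x a"
  shows "x \<in> local_spectral_subspace T F"
  using assms by (auto simp: local_spectral_subspace_def)

lemma local_spectral_subspaceE:
  assumes "x \<in> local_spectral_subspace T F" "0 < r" "cball \<mu> r \<inter> F = {}"
  obtains a where "taylor_solution T \<mu> r x a"
  using assms unfolding local_spectral_subspace_def by blast

lemma csubspace_local_spectral_subspace:
  assumes T: "bounded_clinear T"
  shows "csubspace (local_spectral_subspace T F)"
  unfolding complex_vector.subspace_def
proof (intro conjI ballI allI)
  show "0 \<in> local_spectral_subspace T F"
    by (intro local_spectral_subspaceI exI[of _ "\<lambda>_. 0"])
      (auto simp: taylor_solution_def bounded_clinear_simps[OF T])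
next
  fix x y assume xy: "x \<in> local_spectral_subspace T F" "y \<in> local_spectral_subspace T F"
  show "x + y \<in> local_spectral_subspace T F"
  proof (rule local_spectral_subspaceI)
    fix \<mu> r assume r: "0 < r" "cball \<mu> r \<inter> F = {}"
    obtain a where a: "taylor_solution T \<mu> r x a" by (rule local_spectral_subspaceE[OF xy(1) r])
    obtain b where b: "taylor_solution T \<mu> r y b" by (rule local_spectral_subspaceE[OF xy(2) r])
    show "\<exists>a. taylor_solution T \<mu> r (x + y) a"
      using taylor_solution_add[OF T less_imp_le[OF r(1)] a b] by blast
  qed
next
  fix c x assume x: "x \<in> local_spectral_subspace T F"
  show "c *\<^sub>C x \<in> local_spectral_subspace T F"
  proof (rule local_spectral_subspaceI)
    fix \<mu> r assume r: "0 < r" "cball \<mu> r \<inter> F = {}"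
    obtain a where a: "taylor_solution T \<mu> r x a" by (rule local_spectral_subspaceE[OF x r])
    show "\<exists>a. taylor_solution T \<mu> r (c *\<^sub>C x) a"
      using taylor_solution_scale[OF T a less_imp_le[OF r(1)]] by blast
  qed
qed

definition hyperinvariant :: "('a::complex_banach \<Rightarrow> 'a) \<Rightarrow> 'a set \<Rightarrow> bool"
  where "hyperinvariant T Y \<longleftrightarrow>
    (\<forall>A. bounded_clinear A \<longrightarrow> (\<forall>x. A (T x) = T (A x)) \<longrightarrow> A ` Y \<subseteq> Y)"

lemma hyperinvariantD:
  assumes "hyperinvariant T Y" "bounded_clinear A" "\<And>x. A (T x) = T (A x)" "y \<in> Y"
  shows "A y \<in> Y"
  using assms unfolding hyperinvariant_def by blast

lemma hyperinvariant_local_spectral_subspace: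
  assumes T: "bounded_clinear T"
  shows "hyperinvariant T (local_spectral_subspace T F)"
  unfolding hyperinvariant_def
proof (intro allI impI image_subsetI local_spectral_subspaceI)
  fix A x \<mu> r
  assume A: "bounded_clinear A" "\<forall>x. A (T x) = T (A x)" and x: "x \<in> local_spectral_subspace T F"
    and r: "0 < r" "cball \<mu> r \<inter> F = {}"
  obtain a where a: "taylor_solution T \<mu> r x a" by (rule local_spectral_subspaceE[OF x r])
  show "\<exists>a. taylor_solution T \<mu> r (A x) a"
    using taylor_solution_commuting[OF T A(1) spec[OF A(2)] a less_imp_le[OF r(1)]] by blast
qed

text \<open>The coefficients \<open>(R ^^ Suc k) x\<close> of the resolvent on Y solve the equation,
  and the spectral radius formula gives them the full radius of the disc.\<close>

lemma subset_local_spectral_subspace: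
  assumes T: "bounded_clinear T" and Y: "closed_invariant_subspace T Y"
    and spec: "spectrum_on Y T \<subseteq> F"
  shows "Y \<subseteq> local_spectral_subspace T F"
proof
  fix x assume x: "x \<in> Y"
  show "x \<in> local_spectral_subspace T F"
  proof (rule local_spectral_subspaceI)
    fix \<mu> r assume r: "0 < r" "cball \<mu> r \<inter> F = {}"
    have Y': "csubspace Y" "T ` Y \<subseteq> Y" using Y by (auto simp: closed_invariant_subspace_def)
    have disj: "cball \<mu> r \<inter> spectrum_on Y T = {}" using r spec by blast
    obtain R M where R: "bounded_clinear_on Y R" "\<And>y. y \<in> Y \<Longrightarrow> R (T y - \<mu> *\<^sub>C y) = y"
      "\<And>y. y \<in> Y \<Longrightarrow> T (R y) - \<mu> *\<^sub>C R y = y"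
      and M: "M > 0" "\<And>n y. y \<in> Y \<Longrightarrow> norm ((R ^^ n) y) * r ^ n \<le> M * norm y"
      by (rule resolvent_power_bound[OF T Y' less_imp_le[OF r(1)] disj], rule that)
    have RnY: "(R ^^ n) x \<in> Y" for n
      using bounded_clinear_onD(1)[OF bounded_clinear_on_funpow[OF R(1)] x] .
    have bnd: "norm ((R ^^ Suc k) x) * r ^ k \<le> M * norm x / r" for k
    proof -
      have "norm ((R ^^ Suc k) x) * r ^ k * r \<le> M * norm x"
        using M(2)[OF x, of "Suc k"] by (simp only: power_Suc mult_ac)
      then show ?thesis using r(1) by (simp only: pos_le_divide_eq)
    qed
    have eq: "T ((R ^^ Suc k) x) - \<mu> *\<^sub>C (R ^^ Suc k) x = (R ^^ k) x" for k
      using R(3)[OF RnY[of k]] by simp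
    have "taylor_solution T \<mu> r x (\<lambda>k. (R ^^ Suc k) x)"
      unfolding taylor_solution_def
    proof (intro conjI allI exI)
      show "T ((R ^^ Suc 0) x) - \<mu> *\<^sub>C (R ^^ Suc 0) x = x" using eq[of 0] by simp
    qed (rule eq bnd)+
    then show "\<exists>a. taylor_solution T \<mu> r x a" by blast
  qed
qed

text \<open>Provides the spare radius that the Bishop bound and the division by \<lambda> - \<kappa>
  consume.\<close>

lemma larger_disjoint_cball:
  fixes F :: "complex set"
  assumes "closed F" "0 < r" "cball \<mu> r \<inter> F = {}"
  obtains r' where "r < r'" "cball \<mu> r' \<inter> F = {}"
proof (cases "F = {}")
  case True
  then show ?thesis using that[of "r + 1"] by simp
next
  case False
  obtain z where z: "z \<in> F" "infdist \<mu> F = dist \<mu> z"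
    using infdist_attains_inf[OF assms(1) False] by blast
  have "z \<notin> cball \<mu> r" using z assms by blast
  then have "r < infdist \<mu> F" using z by simp
  then obtain r' where r': "r < r'" "r' < infdist \<mu> F" using dense by blast
  have "cball \<mu> r' \<inter> F = {}"
  proof (rule ccontr)
    assume "cball \<mu> r' \<inter> F \<noteq> {}"
    then obtain w where w: "w \<in> cball \<mu> r'" "w \<in> F" by blast
    then have "infdist \<mu> F \<le> dist \<mu> w" by (intro infdist_le)
    then show False using w r' by simp
  qed
  with r'(1) show ?thesis by (rule that)
qed

text \<open>The Bishop bound for differences makes each coefficient a Cauchy sequence. The limits
  solve the equation for the limit vector and inherit the same bound.\<close>

lemma closed_local_spectral_subspace:
  fixes T :: "'a::complex_banach \<Rightarrow> 'a"
  assumes T: "decomposable T" and F: "closed F"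
  shows "closed (local_spectral_subspace T F)"
  unfolding closed_sequential_limits
proof (intro allI impI, elim conjE)
  fix x :: "nat \<Rightarrow> 'a" and l
  assume mem: "\<forall>n. x n \<in> local_spectral_subspace T F" and lim: "x \<longlonglongrightarrow> l"
  have Tl: "bounded_clinear T" using T by (simp add: decomposable_def)
  show "l \<in> local_spectral_subspace T F"
  proof (rule local_spectral_subspaceI)
    fix \<mu> r assume r: "0 < r" "cball \<mu> r \<inter> F = {}"
    obtain r' where r': "r < r'" "cball \<mu> r' \<inter> F = {}" by (rule larger_disjoint_cball[OF F r])
    have r'pos: "0 < r'" using r r' by simp
    have "\<exists>a. taylor_solution T \<mu> r' (x n) a" for n
      by (rule local_spectral_subspaceE[OF spec[OF mem] r'pos r'(2)]) blast
    then obtain a where a: "\<And>n. taylor_solution T \<mu> r' (x n) (a n)" by metis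
    obtain C where C: "C > 0"
      "\<And>x a k. taylor_solution T \<mu> r' x a \<Longrightarrow> norm (a k) * r ^ k \<le> C * norm x"
      by (rule taylor_solution_bound[OF T r(1) r'(1)], rule that)
    have diff: "norm (a n k - a m k) * r ^ k \<le> C * norm (x n - x m)" for n m k
      using C(2)[OF taylor_solution_diff[OF Tl less_imp_le[OF r'pos] a[of n] a[of m]]] .
    have "Cauchy (\<lambda>n. a n k)" for k
      unfolding Cauchy_altdef2
    proof (intro allI impI)
      fix e :: real assume e: "e > 0"
      have "Cauchy x" using lim by (rule LIMSEQ_imp_Cauchy)
      moreover have "e * r ^ k / C > 0" using e r C by simp
      ultimately obtain N where N: "\<And>n. n \<ge> N \<Longrightarrow> dist (x n) (x N) < e * r ^ k / C"
        unfolding Cauchy_altdef2 by blast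
      have "dist (a n k) (a N k) < e" if "n \<ge> N" for n
      proof -
        have "C * norm (x n - x N) < e * r ^ k"
          using N[OF that] C(1) by (simp add: dist_norm pos_less_divide_eq mult.commute)
        then have "norm (a n k - a N k) * r ^ k < e * r ^ k" using diff[of n k N] by linarith
        then show ?thesis using r by (simp add: dist_norm)
      qed
      then show "\<exists>N. \<forall>n\<ge>N. dist (a n k) (a N k) < e" by blast
    qed
    then have "\<exists>b. (\<lambda>n. a n k) \<longlonglongrightarrow> b" for k
      using Cauchy_convergent convergent_def by blast
    then obtain b where b: "\<And>k. (\<lambda>n. a n k) \<longlonglongrightarrow> b k" by metis
    have bl: "bounded_linear (\<lambda>x. T x - \<mu> *\<^sub>C x)"
      using bounded_clinear_shift[OF Tl, of \<mu>] unfolding bounded_clinear_def by (rule conjunct1)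
    have Tb: "(\<lambda>n. T (a n k) - \<mu> *\<^sub>C a n k) \<longlonglongrightarrow> T (b k) - \<mu> *\<^sub>C b k" for k
      by (rule bounded_linear.tendsto[OF bl b])
    have "taylor_solution T \<mu> r l b"
      unfolding taylor_solution_def
    proof (intro conjI allI exI)
      show "T (b 0) - \<mu> *\<^sub>C b 0 = l"
        using Tb[of 0] lim a by (intro LIMSEQ_unique[OF Tb[of 0]]) (simp add: taylor_solution_def)
      show "T (b (Suc k)) - \<mu> *\<^sub>C b (Suc k) = b k" for k
        using b[of k] a by (intro LIMSEQ_unique[OF Tb[of "Suc k"]]) (simp add: taylor_solution_def)
      show "norm (b k) * r ^ k \<le> C * norm l" for k
        by (rule LIMSEQ_le[OF tendsto_mult_right[OF tendsto_norm[OF b]] tendsto_mult_left[OF tendsto_norm[OF lim]]])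
          (auto intro: C(2)[OF a])
    qed
    then show "\<exists>b. taylor_solution T \<mu> r l b" by blast
  qed
qed

text \<open>
  The value at \<open>\<kappa>\<close> of the local resolvent of \<open>x\<close> has the local resolvent
  \<open>\<lambda> \<mapsto> (f \<lambda> - f \<kappa>) / (\<lambda> - \<kappa>)\<close>. If \<open>\<kappa>\<close> lies in the disc around \<open>\<mu>\<close> its coefficients come from
  continuation of \<open>f\<close> to \<open>\<kappa>\<close>, otherwise \<open>\<lambda> - \<kappa>\<close> has no zero in the disc and the coefficients are
  found recursively.
\<close>

lemma taylor_solution_in_local_spectral_subspace:
  assumes T: "decomposable T" and F: "closed F"
    and x: "x \<in> local_spectral_subspace T F"
    and a: "taylor_solution T \<kappa> s x a" and s: "s > 0"
  shows "a 0 \<in> local_spectral_subspace T F"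
proof (rule local_spectral_subspaceI)
  fix \<mu> r assume r: "0 < r" "cball \<mu> r \<inter> F = {}"
  have Tl: "bounded_clinear T" using T by (simp add: decomposable_def)
  obtain r' where r': "r < r'" "cball \<mu> r' \<inter> F = {}" by (rule larger_disjoint_cball[OF F r])
  have r'pos: "0 < r'" using r r' by simp
  obtain b where b: "taylor_solution T \<mu> r' x b" by (rule local_spectral_subspaceE[OF x r'pos r'(2)])
  show "\<exists>g. taylor_solution T \<mu> r (a 0) g"
  proof (cases "dist \<mu> \<kappa> < r'")
    case True
    obtain c g where c: "taylor_solution T \<kappa> (r' - dist \<mu> \<kappa>) x c" and g: "taylor_solution T \<mu> r' (c 0) g"
      by (rule taylor_solution_recentre[OF Tl b True], rule that)
    \<comment> \<open>The radius s of \<open>a\<close> is unrelated to that of the continued series,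
      but uniqueness identifies the two, so \<open>a 0\<close> is the continued value at
      \<kappa>.\<close>
    have "c = a" using True by (intro taylor_solution_unique[OF T _ s c a]) simp
    then have "taylor_solution T \<mu> r (a 0) g" using taylor_solution_mono[OF g, of r] r r' by simp
    then show ?thesis by blast
  next
    case False
    define d where "d = \<kappa> - \<mu>"
    have d: "cmod d > r" using False r' by (simp add: d_def dist_norm norm_minus_commute)
    then have d0: "d \<noteq> 0" using r by auto
    obtain B where b0: "T (b 0) - \<mu> *\<^sub>C b 0 = x" and bS: "\<And>k. T (b (Suc k)) - \<mu> *\<^sub>C b (Suc k) = b k"
      and B: "\<And>k. norm (b k) * r ^ k \<le> B"
      by (rule taylor_solutionE[OF taylor_solution_mono[OF b less_imp_le[OF r(1)] less_imp_le[OF r'(1)]]], rule that)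
    define S where "S = (\<lambda>x. T x - \<mu> *\<^sub>C x)"
    have S: "bounded_clinear S" unfolding S_def by (rule bounded_clinear_shift[OF Tl])
    have Sb: "S (b 0) = x" "S (b (Suc k)) = b k" for k using b0 bS by (simp_all add: S_def)
    have Sa: "S (a 0) = x + d *\<^sub>C a 0"
      using a by (auto simp: taylor_solution_def S_def d_def complex_vector.scale_left_diff_distrib)
    \<comment> \<open>Comparing coefficients in (\<lambda> - \<kappa>) g = f - \<open>a 0\<close>,
      with \<lambda> - \<kappa> = (\<lambda> - \<mu>) - d.\<close>
    define g where "g = rec_nat ((1 / d) *\<^sub>C (a 0 - b 0)) (\<lambda>k y. (1 / d) *\<^sub>C (y - b (Suc k)))"
    have g0: "g 0 = (1 / d) *\<^sub>C (a 0 - b 0)" and gS: "g (Suc k) = (1 / d) *\<^sub>C (g k - b (Suc k))" for k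
      by (simp_all add: g_def)
    have "S (g 0) = (1 / d) *\<^sub>C (S (a 0) - S (b 0))"
      by (simp only: g0 bounded_clinear_simps[OF S])
    also have "\<dots> = (1 / d) *\<^sub>C (d *\<^sub>C a 0)" unfolding Sa Sb by simp
    also have "\<dots> = a 0" using d0 by (simp add: scaleC_one)
    finally have Sg0: "S (g 0) = a 0" .
    have SgS: "S (g (Suc k)) = g k" for k
    proof (induction k)
      case 0
      have "S (g (Suc 0)) = (1 / d) *\<^sub>C (S (g 0) - S (b (Suc 0)))"
        by (simp only: gS bounded_clinear_simps[OF S])
      also have "\<dots> = g 0" unfolding Sg0 Sb by (simp only: g0)
      finally show ?case .
    next
      case (Suc k)
      have "S (g (Suc (Suc k))) = (1 / d) *\<^sub>C (S (g (Suc k)) - S (b (Suc (Suc k))))"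
        unfolding gS[of "Suc k"] by (simp add: bounded_clinear_simps[OF S])
      also have "\<dots> = g (Suc k)" unfolding Suc Sb by (simp add: gS)
      finally show ?case .
    qed
    \<comment> \<open>The recursion sends a bound M to (r M + B) / |d|. Its fixed point is B / (|d|
      - r), finite since |d| > r; adding the norm of \<open>g 0\<close> covers the start.\<close>
    have "norm (g k) * r ^ k \<le> norm (g 0) + B / (cmod d - r)" for k
    proof (induction k)
      case 0
      have "B \<ge> 0" using order_trans[OF norm_ge_zero[of "b 0"], of B] B[of 0] by simp
      then show ?case using r d by simp
    next
      case (Suc k)
      let ?M = "norm (g 0) + B / (cmod d - r)"
      have "norm (g (Suc k)) * r ^ Suc k = norm (g k - b (Suc k)) * r ^ Suc k / cmod d"
        by (simp add: gS norm_scaleC norm_divide)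
      also have "\<dots> \<le> (norm (g k) + norm (b (Suc k))) * r ^ Suc k / cmod d"
        using r by (intro divide_right_mono mult_right_mono norm_triangle_ineq4) auto
      also have "\<dots> = (r * (norm (g k) * r ^ k) + norm (b (Suc k)) * r ^ Suc k) / cmod d"
        by (simp add: algebra_simps)
      also have "\<dots> \<le> (r * ?M + B) / cmod d"
        using r by (intro divide_right_mono add_mono mult_left_mono Suc B) auto
      also have "\<dots> \<le> ?M"
      proof -
        have "(cmod d - r) * ?M = (cmod d - r) * norm (g 0) + B" using d by (simp add: field_simps)
        also have "\<dots> \<ge> B" using d by simp
        finally have "r * ?M + B \<le> ?M * cmod d" by (simp add: left_diff_distrib mult.commute)
        moreover have "cmod d > 0" using d0 by simp
        ultimately show ?thesis by (simp only: pos_divide_le_eq)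
      qed
      finally show ?case .
    qed
    then have "taylor_solution T \<mu> r (a 0) g"
      using Sg0 SgS unfolding taylor_solution_def S_def by blast
    then show ?thesis by blast
  qed
qed

text \<open>The zeroth coefficient around \<mu> is a preimage under T - \<mu> that stays in the
  subspace. The lower bound is the Bishop bound for a solution belonging to (T - \<mu>) u whose
  zeroth coefficient is u.\<close>

lemma spectrum_on_local_spectral_subspace:
  assumes T: "decomposable T" and F: "closed F"
  shows "spectrum_on (local_spectral_subspace T F) T \<subseteq> F"
proof -
  let ?X = "local_spectral_subspace T F"
  have Tl: "bounded_clinear T" using T by (simp add: decomposable_def)
  have X: "csubspace ?X" by (rule csubspace_local_spectral_subspace[OF Tl])
  have TX: "T u \<in> ?X" if "u \<in> ?X" for u
    by (rule hyperinvariantD[OF hyperinvariant_local_spectral_subspace[OF Tl] Tl refl that])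
  have "\<mu> \<notin> spectrum_on ?X T" if \<mu>: "\<mu> \<notin> F" for \<mu>
  proof -
    obtain r where r: "r > 0" "cball \<mu> r \<inter> F = {}"
    proof -
      have "open (- F)" using F by (simp add: open_Compl)
      then obtain e where "e > 0" "cball \<mu> e \<subseteq> - F" using \<mu> open_contains_cball by blast
      then show thesis using that by blast
    qed
    have half: "0 < r / 2" "r / 2 < r" using r by auto
    obtain C where C: "C > 0"
      "\<And>x a k. taylor_solution T \<mu> r x a \<Longrightarrow> norm (a k) * (r / 2) ^ k \<le> C * norm x"
      by (rule taylor_solution_bound[OF T half], rule that)
    show ?thesis
    proof (rule notin_spectrum_onI[OF X Tl])
      fix x assume x: "x \<in> ?X"
      obtain a where a: "taylor_solution T \<mu> r x a" by (rule local_spectral_subspaceE[OF x r])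
      have "a 0 \<in> ?X" by (rule taylor_solution_in_local_spectral_subspace[OF T F x a r(1)])
      moreover have "T (a 0) - \<mu> *\<^sub>C a 0 = x" using a by (simp add: taylor_solution_def)
      ultimately show "\<exists>u\<in>?X. T u - \<mu> *\<^sub>C u = x" by blast
    next
      fix u assume u: "u \<in> ?X"
      obtain a where a: "taylor_solution T \<mu> r u a" by (rule local_spectral_subspaceE[OF u r])
      obtain B where a0: "T (a 0) - \<mu> *\<^sub>C a 0 = u"
        and aS: "\<And>k. T (a (Suc k)) - \<mu> *\<^sub>C a (Suc k) = a k"
        and B: "\<And>k. norm (a k) * r ^ k \<le> B"
        by (rule taylor_solutionE[OF a], rule that)
      \<comment> \<open>If f is the local resolvent of u, then u + (\<lambda> - \<mu>) f(\<lambda>)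
        is that of (T - \<mu>) u; its coefficients are those of f shifted by one, with u in
        front.\<close>
      define c where "c = case_nat u a"
      have "T (c (Suc k)) - \<mu> *\<^sub>C c (Suc k) = c k" for k
        by (cases k) (simp_all add: c_def a0 aS)
      moreover have "norm (c k) * r ^ k \<le> norm u + r * B" for k
      proof (cases k)
        case 0
        have "B \<ge> 0" using order_trans[OF norm_ge_zero[of "a 0"], of B] B[of 0] by simp
        then show ?thesis using r 0 by (simp add: c_def)
      next
        case (Suc m)
        have "r * (norm (a m) * r ^ m) \<le> r * B" using r by (intro mult_left_mono B) auto
        then have "norm (c k) * r ^ k \<le> r * B" by (simp add: Suc c_def mult_ac)
        then show ?thesis using norm_ge_zero[of u] by linarith
      qed
      ultimately have "taylor_solution T \<mu> r (T u - \<mu> *\<^sub>C u) c"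
        unfolding taylor_solution_def by (auto simp: c_def)
      from C(2)[OF this, of 0] show "norm u \<le> C * norm (T u - \<mu> *\<^sub>C u)" by (simp add: c_def)
    qed (use TX in blast)
  qed
  then show ?thesis by blast
qed

section \<open>Decompositions into hyperinvariant subspaces\<close>

lemma open_between_closed_open:
  fixes S P :: "'a::euclidean_space set"
  assumes "closed S" "open P" "S \<subseteq> P"
  obtains Q where "open Q" "S \<subseteq> Q" "closure Q \<subseteq> P"
proof -
  have P: "closed (- P)" "S \<inter> - P = {}" using assms by auto
  obtain Q R where Q: "open Q" "open R" "S \<subseteq> Q" "- P \<subseteq> R" "Q \<inter> R = {}"
    by (rule separation_normal[OF assms(1) P])
  then have "closure Q \<subseteq> - R" by (intro closure_minimal) auto
  with Q show ?thesis by (intro that[of Q]) auto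
qed

text \<open>Disjoint neighbourhoods of the complements of U and V are shrunk to \<open>P'\<close>
  and \<open>Q'\<close> with disjoint closures. Then \<open>- P'\<close> and \<open>- Q'\<close> are
  closed and lie in U and V, while the smaller open sets \<open>- closure P'\<close> and
  \<open>- closure Q'\<close> still cover the plane. The subspaces obtained for these open sets sit
  inside the local spectral subspaces of the closed ones.\<close>

lemma decomposable_hyperinvariant:
  fixes T :: "'a::complex_banach \<Rightarrow> 'a"
  assumes T: "decomposable T" and UV: "open U" "open V" "U \<union> V = UNIV"
  obtains Y Z where "csubspace Y" "closed Y" "csubspace Z" "closed Z"
    "hyperinvariant T Y" "hyperinvariant T Z"
    "\<And>x. \<exists>y\<in>Y. \<exists>z\<in>Z. x = y + z"
    "spectrum_on Y T \<subseteq> U" "spectrum_on Z T \<subseteq> V"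
proof -
  have Tl: "bounded_clinear T" using T by (simp add: decomposable_def)
  have "closed (- U)" "closed (- V)" "- U \<inter> - V = {}" using UV by auto
  then obtain P Q where PQ: "open P" "open Q" "- U \<subseteq> P" "- V \<subseteq> Q" "P \<inter> Q = {}"
    using separation_normal by metis
  obtain P' where P': "open P'" "- U \<subseteq> P'" "closure P' \<subseteq> P"
    using open_between_closed_open[of "- U" P] UV PQ by auto
  obtain Q' where Q': "open Q'" "- V \<subseteq> Q'" "closure Q' \<subseteq> Q"
    using open_between_closed_open[of "- V" Q] UV PQ by auto
  have cover: "open (- closure P')" "open (- closure Q')" "- closure P' \<union> - closure Q' = UNIV"
    using P' Q' PQ by auto
  obtain Y Z where YZ: "closed_invariant_subspace T Y" "closed_invariant_subspace T Z"
    "{y + z | y z. y \<in> Y \<and> z \<in> Z} = UNIV"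
    "spectrum_on Y T \<subseteq> - closure P'" "spectrum_on Z T \<subseteq> - closure Q'"
    using T cover unfolding decomposable_def by meson
  have F: "closed (- P')" "closed (- Q')" using P' Q' by auto
  have "spectrum_on Y T \<subseteq> - P'" "spectrum_on Z T \<subseteq> - Q'"
    using YZ closure_subset by blast+
  then have sub: "Y \<subseteq> local_spectral_subspace T (- P')" "Z \<subseteq> local_spectral_subspace T (- Q')"
    using subset_local_spectral_subspace[OF Tl] YZ by blast+
  show thesis
  proof (rule that)
    show "\<exists>y\<in>local_spectral_subspace T (- P'). \<exists>z\<in>local_spectral_subspace T (- Q'). x = y + z" for x
    proof -
      obtain y z where "x = y + z" "y \<in> Y" "z \<in> Z" using YZ(3) by blast
      then show ?thesis using sub by blast
    qed
    show "spectrum_on (local_spectral_subspace T (- P')) T \<subseteq> U"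
      using spectrum_on_local_spectral_subspace[OF T F(1)] P' by blast
    show "spectrum_on (local_spectral_subspace T (- Q')) T \<subseteq> V"
      using spectrum_on_local_spectral_subspace[OF T F(2)] Q' by blast
  qed (rule csubspace_local_spectral_subspace[OF Tl] closed_local_spectral_subspace[OF T]
      hyperinvariant_local_spectral_subspace[OF Tl] F)+
qed


subsection \<open>Polynomials of an operator\<close>

lemma poly_op_altdef:
  assumes "degree p \<le> n"
  shows "poly_op p K x = (\<Sum>i\<le>n. coeff p i *\<^sub>C (K ^^ i) x)"
  unfolding poly_op_def using assms
  by (intro sum.mono_neutral_left) (auto simp: coeff_eq_0)

lemma poly_op_pCons:
  assumes K: "bounded_clinear K"
  shows "poly_op (pCons a p) K x = a *\<^sub>C x + K (poly_op p K x)"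
proof -
  have "poly_op (pCons a p) K x = (\<Sum>i\<le>Suc (degree p). coeff (pCons a p) i *\<^sub>C (K ^^ i) x)"
    by (rule poly_op_altdef) (simp add: degree_pCons_le)
  also have "\<dots> = a *\<^sub>C x + (\<Sum>i\<le>degree p. coeff p i *\<^sub>C K ((K ^^ i) x))"
    by (subst sum.atMost_Suc_shift) simp
  also have "(\<Sum>i\<le>degree p. coeff p i *\<^sub>C K ((K ^^ i) x)) = K (poly_op p K x)"
    by (simp add: poly_op_def bounded_clinear_simps[OF K])
  finally show ?thesis .
qed

lemma poly_op_0 [simp]: "poly_op 0 K x = 0"
  by (simp add: poly_op_def)

lemma poly_op_1 [simp]: "poly_op 1 K x = x"
  by (simp add: poly_op_def scaleC_one)

lemma poly_op_add: "poly_op (p + q) K x = poly_op p K x + poly_op q K x"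
proof -
  let ?n = "max (degree p) (degree q)"
  have "degree (p + q) \<le> ?n" by (rule degree_add_le_max)
  then show ?thesis
    by (simp add: poly_op_altdef[of _ ?n] scaleC_add_left sum.distrib)
qed

lemma poly_op_smult: "poly_op (smult c p) K x = c *\<^sub>C poly_op p K x"
  by (simp add: poly_op_altdef[OF degree_smult_le] poly_op_def complex_vector.scale_sum_right)

lemma poly_op_diff: "poly_op (p - q) K x = poly_op p K x - poly_op q K x"
  using poly_op_add[of "p - q" q K x] by (simp add: algebra_simps)

lemma poly_op_sum: "poly_op (\<Sum>i\<in>I. p i) K x = (\<Sum>i\<in>I. poly_op (p i) K x)"
  by (induction I rule: infinite_finite_induct) (auto simp: poly_op_add)

lemma bounded_clinear_poly_op:
  assumes K: "bounded_clinear K"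
  shows "bounded_clinear (poly_op p K)"
proof (induction p)
  case 0
  then show ?case using bounded_clinear_scaleC_id[of 0] by (simp add: poly_op_def)
next
  case (pCons a p)
  have "bounded_clinear (\<lambda>x. a *\<^sub>C x + K (poly_op p K x))"
    by (rule bounded_clinear_add[OF bounded_clinear_scaleC_id bounded_clinear_compose[OF K pCons(2)]])
  moreover have "poly_op (pCons a p) K = (\<lambda>x. a *\<^sub>C x + K (poly_op p K x))"
    by (intro ext poly_op_pCons K)
  ultimately show ?case by (simp only:)
qed

lemma poly_op_commute:
  assumes A: "bounded_clinear A" and K: "bounded_clinear K" and AK: "\<And>x. A (K x) = K (A x)"
  shows "A (poly_op p K x) = poly_op p K (A x)"
  by (induction p) (simp_all add: poly_op_pCons[OF K] bounded_clinear_simps[OF A] AK)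

lemma poly_op_mult:
  assumes K: "bounded_clinear K"
  shows "poly_op (p * q) K x = poly_op p K (poly_op q K x)"
proof (induction p)
  case (pCons a p)
  then show ?case
    by (simp add: poly_op_add poly_op_smult poly_op_pCons[OF K])
qed simp

lemma poly_op_linear_power:
  assumes K: "bounded_clinear K"
  shows "poly_op ([:- l, 1:] ^ m) K x = ((\<lambda>x. K x - l *\<^sub>C x) ^^ m) x"
proof (induction m)
  case (Suc m)
  have "poly_op [:- l, 1:] K y = K y - l *\<^sub>C y" for y
    by (simp add: poly_op_pCons[OF K] scaleC_one bounded_clinear_simps[OF K])
  then show ?case using Suc by (simp add: poly_op_mult[OF K] del: mult_pCons_left)
qed simp

text \<open>Turns congruences modulo an annihilating polynomial into operator identities, so that
  the idempotents can be built among polynomials.\<close>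

lemma poly_op_dvd:
  assumes K: "bounded_clinear K" and "poly_op p K = (\<lambda>x. 0)" "p dvd q"
  shows "poly_op q K x = 0"
proof -
  obtain r where "q = r * p" using assms(3) by (metis dvdE mult.commute)
  then show ?thesis
    using assms(2) by (simp add: poly_op_mult[OF K] bounded_clinear_simps[OF bounded_clinear_poly_op[OF K]])
qed

section \<open>Spectral idempotents modulo a polynomial\<close>

text \<open>Modulo the linear factor, q is the nonzero constant \<open>poly q l\<close>, which gives
  the relation for exponent 1. The induction step multiplies the term with \<open>u\<close> by that
  relation.\<close>

lemma bezout_linear_power:
  fixes q :: "'a::field poly"
  assumes "poly q l \<noteq> 0"
  shows "\<exists>u v. u * [:- l, 1:] ^ m + v * q = 1"
proof (induction m)
  case 0
  show ?case by (intro exI[of _ 1] exI[of _ 0]) simp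
next
  case (Suc m)
  let ?L = "[:- l, 1:]"
  obtain u v where uv: "u * ?L ^ m + v * q = 1" using Suc by blast
  have "poly (q - [:poly q l:]) l = 0" by simp
  then have "?L dvd q - [:poly q l:]" by (simp only: poly_eq_0_iff_dvd)
  then obtain r where r: "q - [:poly q l:] = ?L * r" by (rule dvdE)
  let ?c = "1 / poly q l"
  have "smult ?c q - smult ?c (?L * r) = 1"
    unfolding r[symmetric] using assms by (simp add: smult_diff_right pCons_one)
  then have 1: "[:?c:] * q - [:?c:] * (?L * r) = 1" by (simp only: mult_pCons_left mult_zero_left pCons_0_0 add_0_right)
  have "(- (u * c * r)) * (L * w) + (u * w * c + v) * q = u * w * (c * q - c * (L * r)) + v * q"
    for c L w :: "'a poly"
    by (simp add: algebra_simps)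
  from this[of "[:?c:]" ?L "?L ^ m"]
  have "(- (u * [:?c:] * r)) * ?L ^ Suc m + (u * ?L ^ m * [:?c:] + v) * q = 1"
    unfolding 1 power_Suc mult_1_right uv .
  then show ?case by blast
qed

text \<open>The Chinese remainder theorem, splitting off one root with its full multiplicity at a
  time. Idempotence modulo p is left implicit: it follows from orthogonality and the sum being
  1.\<close>

lemma poly_spectral_idempotents:
  fixes p :: "complex poly"
  assumes "p \<noteq> 0"
  shows "\<exists>L e. finite L \<and> (\<forall>l\<in>L. poly p l = 0) \<and> p dvd (\<Sum>l\<in>L. e l) - 1 \<and>
    (\<forall>l\<in>L. \<forall>k\<in>L. l \<noteq> k \<longrightarrow> p dvd e l * e k) \<and> (\<forall>l\<in>L. \<exists>m. p dvd [:- l, 1:] ^ m * e l)"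
  using assms
proof (induction "degree p" arbitrary: p rule: less_induct)
  case less
  show ?case
  proof (cases "degree p = 0")
    case True
    \<comment> \<open>A nonzero constant is a unit and divides even the empty sum minus 1. Such a
      polynomial annihilates only operators on the zero space.\<close>
    then have "p dvd q" for q using less.prems by (simp add: is_unit_iff_degree unit_imp_dvd)
    then show ?thesis by (intro exI[of _ "{}"]) simp
  next
    case False
    then obtain l where l: "poly p l = 0"
      using fundamental_theorem_of_algebra[of p] by (auto simp: constant_degree)
    define m where "m = order l p"
    obtain q where q: "p = [:- l, 1:] ^ m * q" "\<not> [:- l, 1:] dvd q"
      using order_decomp[OF less.prems, of l] by (auto simp: m_def)
    have ql: "poly q l \<noteq> 0" using q by (simp add: poly_eq_0_iff_dvd)
    have q0: "q \<noteq> 0" using q by auto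
    have m: "m > 0" using l less.prems by (auto simp: m_def order_root)
    have "degree p = m + degree q"
      unfolding q(1) using q0 by (subst degree_mult_eq) (auto simp: degree_linear_power)
    then have "degree q < degree p" using m by simp
    from less.hyps[OF this q0] obtain L e where L: "finite L" "\<forall>k\<in>L. poly q k = 0"
      and e: "q dvd (\<Sum>k\<in>L. e k) - 1" "\<forall>j\<in>L. \<forall>k\<in>L. j \<noteq> k \<longrightarrow> q dvd e j * e k"
        "\<forall>k\<in>L. \<exists>n. q dvd [:- k, 1:] ^ n * e k" by blast
    obtain u v where uv: "u * [:- l, 1:] ^ m + v * q = 1" using bezout_linear_power[OF ql] by blast
    have lL: "l \<notin> L" using L ql by auto
    define w where "w = [:- l, 1:] ^ m"
    have p: "p = w * q" using q by (simp add: w_def)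
    \<comment> \<open>In 1 = u w + v q the term v q is the idempotent of the new root and u w the
      complementary one. Since u w is 1 modulo q and 0 modulo w, it lifts the idempotents of q to
      p.\<close>
    define e' where "e' = (\<lambda>k. if k = l then v * q else u * w * e k)"
    have e'L: "e' k = u * w * e k" if "k \<in> L" for k using that lL by (auto simp: e'_def)
    have e'l: "e' l = v * q" by (simp add: e'_def)
    have "(\<Sum>k\<in>insert l L. e' k) - 1 = u * w * ((\<Sum>k\<in>L. e k) - 1)"
    proof -
      have "(\<Sum>k\<in>insert l L. e' k) = v * q + u * w * (\<Sum>k\<in>L. e k)"
        using L lL by (simp add: e'L e'l sum_distrib_left)
      moreover have "1 = u * w + v * q" using uv by (simp add: w_def)
      ultimately show ?thesis by (simp add: algebra_simps)
    qed
    also have "p dvd \<dots>" unfolding p using e(1) by (intro mult_dvd_mono) auto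
    finally have 1: "p dvd (\<Sum>k\<in>insert l L. e' k) - 1" .
    have 2: "p dvd e' j * e' k" if jk: "j \<in> insert l L" "k \<in> insert l L" "j \<noteq> k" for j k
    proof -
      have "p dvd v * q * (u * w * f)" for f
        unfolding p by (rule dvdI[of _ _ "v * u * f"]) (simp only: ac_simps)
      moreover have "p dvd u * w * f * (v * q)" for f
        unfolding p by (rule dvdI[of _ _ "v * u * f"]) (simp only: ac_simps)
      moreover have "p dvd u * w * e j * (u * w * e k)" if "j \<in> L" "k \<in> L"
      proof -
        have "w * q dvd w * (e j * e k)" using e(2) that jk by (intro mult_dvd_mono) auto
        then have "w * q dvd (w * (e j * e k)) * (u * w * u)" by (rule dvd_mult2)
        then show ?thesis unfolding p by (simp only: ac_simps)
      qed
      ultimately show ?thesis using jk by (auto simp: e'L e'l)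
    qed
    have 3: "\<exists>n. p dvd [:- k, 1:] ^ n * e' k" if "k \<in> insert l L" for k
    proof (cases "k = l")
      case True
      have "p dvd w * (v * q)" unfolding p by (rule dvdI[of _ _ v]) (simp only: ac_simps)
      then show ?thesis using True by (auto simp: e'l w_def)
    next
      case False
      then have k: "k \<in> L" using that by simp
      then obtain n where "q dvd [:- k, 1:] ^ n * e k" using e(3) by blast
      then have "w * q dvd w * ([:- k, 1:] ^ n * e k) * u"
        by (intro dvd_mult2[OF mult_dvd_mono[OF dvd_refl]])
      then have "p dvd [:- k, 1:] ^ n * e' k" unfolding p e'L[OF k] by (simp only: ac_simps)
      then show ?thesis by blast
    qed
    have "\<forall>k\<in>insert l L. poly p k = 0" using L l by (auto simp: q(1))
    then show ?thesis
      using L(1) 1 2 3 by (intro exI[of _ "insert l L"] exI[of _ e']) blast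
  qed
qed

section \<open>Nilpotent perturbations of the resolvent\<close>

text \<open>N commutes with G = T + N - \<kappa> and lowers the kernel index by one, so the previous
  estimate bounds N u by N G u, hence by G u. Then u is recovered as R (G u - N u).\<close>

lemma nilpotent_perturbation_lower_bound:
  assumes W: "csubspace W" and T: "bounded_clinear T" and N: "bounded_clinear N"
    and TW: "T ` W \<subseteq> W" and NW: "N ` W \<subseteq> W" and TN: "\<And>x. T (N x) = N (T x)"
    and \<kappa>: "\<kappa> \<notin> spectrum_on W T"
  shows "\<exists>C. \<forall>u\<in>W. (N ^^ m) u = 0 \<longrightarrow> norm u \<le> C * norm (T u + N u - \<kappa> *\<^sub>C u)"
proof (induction m)
  case 0
  show ?case by (intro exI[of _ 0]) simp
next
  case (Suc m)
  note [simp] = complex_vector.subspace_scale[OF W] complex_vector.subspace_diff[OF W]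
  have [simp]: "T u \<in> W" if "u \<in> W" for u using TW that by auto
  obtain C where C: "\<And>u. u \<in> W \<Longrightarrow> (N ^^ m) u = 0 \<Longrightarrow> norm u \<le> C * norm (T u + N u - \<kappa> *\<^sub>C u)"
    using Suc by blast
  obtain R where R: "bounded_clinear_on W R" "\<And>y. y \<in> W \<Longrightarrow> R (T y - \<kappa> *\<^sub>C y) = y"
    "\<And>y. y \<in> W \<Longrightarrow> T (R y) - \<kappa> *\<^sub>C R y = y"
    by (rule notin_spectrum_onE[OF \<kappa>], rule that)
  obtain b where b: "b > 0" "\<And>y. y \<in> W \<Longrightarrow> norm (R y) \<le> b * norm y"
    using bounded_clinear_on_bound[OF R(1)] by blast
  obtain n where n: "n > 0" "\<And>y. norm (N y) \<le> n * norm y" using bounded_clinear_bound[OF N] by blast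
  have "norm u \<le> b * (1 + \<bar>C\<bar> * n) * norm (T u + N u - \<kappa> *\<^sub>C u)" if u: "u \<in> W" "(N ^^ Suc m) u = 0" for u
  proof -
    let ?v = "T u + N u - \<kappa> *\<^sub>C u"
    have "(N ^^ m) (N u) = 0" using u(2) by (simp add: funpow_swap1)
    moreover have "N u \<in> W" using NW u by auto
    ultimately have "norm (N u) \<le> C * norm (T (N u) + N (N u) - \<kappa> *\<^sub>C N u)" by (intro C)
    also have "T (N u) + N (N u) - \<kappa> *\<^sub>C N u = N ?v"
      by (simp add: TN bounded_clinear_simps[OF N])
    also have "C * norm (N ?v) \<le> \<bar>C\<bar> * (n * norm ?v)" by (intro mult_mono n) auto
    finally have Nu: "norm (N u) \<le> \<bar>C\<bar> * n * norm ?v" by simp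
    have "norm u = norm (R (T u - \<kappa> *\<^sub>C u))" using R(2)[OF u(1)] by simp
    also have "\<dots> \<le> b * norm (T u - \<kappa> *\<^sub>C u)" using u by (intro b) simp
    also have "T u - \<kappa> *\<^sub>C u = ?v - N u" by simp
    also have "b * norm (?v - N u) \<le> b * (norm ?v + \<bar>C\<bar> * n * norm ?v)"
      using b(1) norm_triangle_ineq4[of ?v "N u"] Nu by (intro mult_left_mono) auto
    finally show ?thesis by (simp add: algebra_simps)
  qed
  then show ?case by blast
qed

text \<open>The unperturbed solution v = R w leaves the error N v, which is killed by one power of N
  less. The induction hypothesis supplies a correction u, and v - u is the solution. That v stays in
  the kernel follows from injectivity of T - \<kappa> on W.\<close>

lemma nilpotent_perturbation_surjective:
  assumes W: "csubspace W" and T: "bounded_clinear T" and N: "bounded_clinear N"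
    and TW: "T ` W \<subseteq> W" and NW: "N ` W \<subseteq> W" and TN: "\<And>x. T (N x) = N (T x)"
    and \<kappa>: "\<kappa> \<notin> spectrum_on W T" and w: "w \<in> W" "(N ^^ m) w = 0"
  shows "\<exists>u\<in>W. (N ^^ m) u = 0 \<and> T u + N u - \<kappa> *\<^sub>C u = w"
  using w
proof (induction m arbitrary: w)
  case 0
  then show ?case
    by (intro bexI[of _ 0])
      (auto simp: complex_vector.subspace_0[OF W] bounded_clinear_simps[OF T] bounded_clinear_simps[OF N])
next
  case (Suc m)
  obtain R where R: "bounded_clinear_on W R" "\<And>y. y \<in> W \<Longrightarrow> R (T y - \<kappa> *\<^sub>C y) = y"
    "\<And>y. y \<in> W \<Longrightarrow> T (R y) - \<kappa> *\<^sub>C R y = y"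
    by (rule notin_spectrum_onE[OF \<kappa>], rule that)
  have inj: "u = 0" if "u \<in> W" "T u - \<kappa> *\<^sub>C u = 0" for u
    using R(2)[OF that(1)] that(2) bounded_clinear_on_0[OF W R(1)] by simp
  define v where "v = R w"
  have v: "v \<in> W" "T v - \<kappa> *\<^sub>C v = w"
    using R(3)[OF Suc.prems(1)] bounded_clinear_onD(1)[OF R(1) Suc.prems(1)] by (simp_all add: v_def)
  have NnW: "(N ^^ k) v \<in> W" for k using v NW by (induction k) auto
  have comm: "T ((N ^^ k) x) = (N ^^ k) (T x)" for k x by (induction k) (simp_all add: TN)
  have lin: "bounded_clinear (N ^^ Suc m)" by (rule bounded_clinear_funpow[OF N])
  have "T ((N ^^ Suc m) v) - \<kappa> *\<^sub>C (N ^^ Suc m) v = (N ^^ Suc m) (T v - \<kappa> *\<^sub>C v)"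
    by (simp only: comm bounded_clinear_simps[OF lin])
  also have "\<dots> = 0" unfolding v(2) by (rule Suc.prems(2))
  finally have Nv: "(N ^^ Suc m) v = 0" by (rule inj[OF NnW])
  then have "(N ^^ m) (N v) = 0" by (simp add: funpow_swap1)
  moreover have "N v \<in> W" using v NW by auto
  ultimately obtain u where u: "u \<in> W" "(N ^^ m) u = 0" "T u + N u - \<kappa> *\<^sub>C u = N v"
    using Suc.IH by blast
  have "(N ^^ Suc m) u = 0" using u(2) bounded_clinear_simps(3)[OF N] by simp
  then have "(N ^^ Suc m) (v - u) = 0" using Nv by (simp only: bounded_clinear_simps[OF lin] diff_self)
  moreover have "T (v - u) + N (v - u) - \<kappa> *\<^sub>C (v - u) = (T v - \<kappa> *\<^sub>C v) + N v - (T u + N u - \<kappa> *\<^sub>C u)"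
    by (simp add: bounded_clinear_simps[OF N] bounded_clinear_simps[OF T] complex_vector.scale_right_diff_distrib)
  then have "T (v - u) + N (v - u) - \<kappa> *\<^sub>C (v - u) = w" using u v by simp
  moreover have "v - u \<in> W" using u v by (intro complex_vector.subspace_diff W)
  ultimately show ?case by blast
qed


subsection \<open>Algebraic perturbations\<close>

text \<open>
  The operators \<open>P l\<close> are the Riesz idempotents of \<open>K\<close>: on the range of \<open>P l\<close> the operator \<open>K\<close> is
  the scalar \<open>l\<close> plus a nilpotent, so \<open>T + K\<close> has there the spectrum of \<open>T\<close> shifted by \<open>l\<close>.
\<close>

locale commuting_idempotents =
  fixes T K :: "'a::complex_banach \<Rightarrow> 'a" and L :: "complex set" and P :: "complex \<Rightarrow> 'a \<Rightarrow> 'a"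
  assumes T: "bounded_clinear T" and K: "bounded_clinear K" and P: "\<And>l. bounded_clinear (P l)"
    and KT: "\<And>x. K (T x) = T (K x)" and PT: "\<And>l x. P l (T x) = T (P l x)"
    and PK: "\<And>l x. P l (K x) = K (P l x)"
    and finite: "finite L" and sum_P: "\<And>x. (\<Sum>l\<in>L. P l x) = x"
    and P_orth: "\<And>l k x. l \<in> L \<Longrightarrow> k \<in> L \<Longrightarrow> l \<noteq> k \<Longrightarrow> P l (P k x) = 0"
    and P_nilpotent: "\<And>l. l \<in> L \<Longrightarrow> \<exists>m. \<forall>x. ((\<lambda>x. K x - l *\<^sub>C x) ^^ m) (P l x) = 0"
begin

lemma P_idem:
  assumes l: "l \<in> L"
  shows "P l (P l x) = P l x"
proof -
  have "P l x = (\<Sum>k\<in>L. P l (P k x))"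
    using sum_P[of x] by (simp flip: bounded_clinear_simps(4)[OF P])
  also have "\<dots> = (\<Sum>k\<in>L. if k = l then P l (P l x) else 0)"
    using l P_orth by (intro sum.cong) auto
  also have "\<dots> = P l (P l x)" using l finite by simp
  finally show ?thesis by simp
qed

text \<open>The direct sum over \<open>l \<in> L\<close> of the intersections of \<open>W l\<close>
  with the range of \<open>P l\<close>. The family is indexed because the shift of the cover depends
  on l; the form as preimages makes closedness immediate.\<close>

definition combine :: "(complex \<Rightarrow> 'a set) \<Rightarrow> 'a set"
  where "combine W = {x. \<forall>l\<in>L. P l x \<in> W l}"

lemma P_sum_P:
  assumes l: "l \<in> L"
  shows "P l (\<Sum>k\<in>L. P k (f k)) = P l (f l)"
proof -
  have "P l (\<Sum>k\<in>L. P k (f k)) = (\<Sum>k\<in>L. P l (P k (f k)))"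
    by (rule bounded_clinear_simps(4)[OF P])
  also have "\<dots> = (\<Sum>k\<in>L. if k = l then P l (f l) else 0)"
    using l P_orth P_idem by (intro sum.cong) auto
  also have "\<dots> = P l (f l)" using l finite by simp
  finally show ?thesis .
qed

lemma sum_in_combine:
  assumes "\<And>l. l \<in> L \<Longrightarrow> P l (f l) \<in> W l"
  shows "(\<Sum>l\<in>L. P l (f l)) \<in> combine W"
  using assms by (auto simp: combine_def P_sum_P)

lemma closed_combine:
  assumes "\<And>l. closed (W l)"
  shows "closed (combine W)"
proof -
  have "combine W = (\<Inter>l\<in>L. P l -` W l)" by (auto simp: combine_def)
  moreover have "closed (P l -` W l)" for l
    by (intro closed_vimage assms bounded_clinear_continuous P)
  ultimately show ?thesis by auto
qed

lemma csubspace_combine: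
  assumes "\<And>l. csubspace (W l)"
  shows "csubspace (combine W)"
  using assms unfolding complex_vector.subspace_def combine_def
  by (auto simp: bounded_clinear_simps[OF P])

lemma invariant_combine:
  assumes W: "\<And>l. csubspace (W l)"
    and hyper: "\<And>l. hyperinvariant T (W l)"
  shows "(\<lambda>x. T x + K x) ` combine W \<subseteq> combine W"
proof -
  have "P l (T x + K x) \<in> W l" if l: "l \<in> L" and x: "x \<in> combine W" for l x
  proof -
    have "P l x \<in> W l" using x l by (auto simp: combine_def)
    then show ?thesis
      using hyperinvariantD[OF hyper T refl] hyperinvariantD[OF hyper K KT]
      by (simp add: bounded_clinear_simps[OF P] PT PK complex_vector.subspace_add[OF W])
  qed
  then show ?thesis by (auto simp: combine_def)
qed

text \<open>With N = K - l one has T + K - \<mu> = T + N - (\<mu> - l), so each block is a nilpotent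
  perturbation of T at a point off its spectrum on \<open>W l\<close>. As L is finite, solutions and
  bounds of the blocks can be added.\<close>

lemma spectrum_on_combine:
  assumes W: "\<And>l. csubspace (W l)"
    and hyper: "\<And>l. hyperinvariant T (W l)"
    and spec: "\<And>l. spectrum_on (W l) T \<subseteq> {z. z + l \<in> U}"
  shows "spectrum_on (combine W) (\<lambda>x. T x + K x) \<subseteq> U"
proof -
  define G where "G = (\<lambda>\<mu> x. T x + K x - \<mu> *\<^sub>C x)"
  have TK: "bounded_clinear (\<lambda>x. T x + K x)" by (rule bounded_clinear_add[OF T K])
  have G: "bounded_clinear (G \<mu>)" for \<mu>
    unfolding G_def by (rule bounded_clinear_shift[OF TK])
  have PG: "P l (G \<mu> x) = G \<mu> (P l x)" for l \<mu> x
    by (simp add: G_def bounded_clinear_simps[OF P] PT PK)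
  have "\<mu> \<notin> spectrum_on (combine W) (\<lambda>x. T x + K x)" if \<mu>: "\<mu> \<notin> U" for \<mu>
  proof -
    have 1: "\<exists>C. \<forall>u. P l u \<in> W l \<longrightarrow> norm (P l u) \<le> C * norm (G \<mu> (P l u))"
      and 2: "P l w \<in> W l \<Longrightarrow> \<exists>u\<in>W l. G \<mu> u = P l w" if l: "l \<in> L" for l w
    proof -
      define N where "N = (\<lambda>x. K x - l *\<^sub>C x)"
      have N: "bounded_clinear N" unfolding N_def by (rule bounded_clinear_shift[OF K])
      have TN: "T (N x) = N (T x)" for x
        by (simp add: N_def KT bounded_clinear_simps[OF T])
      have \<kappa>: "\<mu> - l \<notin> spectrum_on (W l) T" using spec[of l] \<mu> by auto
      have inv: "T ` W l \<subseteq> W l" "N ` W l \<subseteq> W l"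
        using hyperinvariantD[OF hyper T refl] hyperinvariantD[OF hyper N TN[symmetric]] by auto
      have eq: "T u + N u - (\<mu> - l) *\<^sub>C u = G \<mu> u" for u
        by (simp add: G_def N_def complex_vector.scale_left_diff_distrib)
      obtain m where m: "\<And>x. (N ^^ m) (P l x) = 0" using P_nilpotent[OF l] unfolding N_def by blast
      show "\<exists>C. \<forall>u. P l u \<in> W l \<longrightarrow> norm (P l u) \<le> C * norm (G \<mu> (P l u))"
        using nilpotent_perturbation_lower_bound[OF W T N inv TN \<kappa>, of m] m unfolding eq by blast
      show "\<exists>u\<in>W l. G \<mu> u = P l w" if "P l w \<in> W l"
        using nilpotent_perturbation_surjective[OF W T N inv TN \<kappa> that m] unfolding eq by blast
    qed
    obtain c where c: "\<And>l u. l \<in> L \<Longrightarrow> P l u \<in> W l \<Longrightarrow> norm (P l u) \<le> c l * norm (G \<mu> (P l u))"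
      using 1 by metis
    obtain b where b: "\<And>l. b l > 0" "\<And>l x. norm (P l x) \<le> b l * norm x"
    proof -
      have "\<exists>b>0. \<forall>x. norm (P l x) \<le> b * norm x" for l
        by (rule bounded_clinear_bound[OF P[of l]]) blast
      then show thesis using that by metis
    qed
    show ?thesis
    proof (rule notin_spectrum_onI[OF csubspace_combine[OF W] TK])
      fix w assume w: "w \<in> combine W"
      have "\<exists>u\<in>W l. G \<mu> u = P l w" if "l \<in> L" for l
        using 2[OF that] w that by (auto simp: combine_def)
      then obtain u where u: "\<And>l. l \<in> L \<Longrightarrow> u l \<in> W l \<and> G \<mu> (u l) = P l w" by metis
      \<comment> \<open>The block solution \<open>u l\<close> need not lie in the range of
        \<open>P l\<close>, hence the projection before summing. Hyperinvariance keeps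
        \<open>P l (u l)\<close> in \<open>W l\<close>, and \<open>P l\<close> fixes the right-hand
        side.\<close>
      have "G \<mu> (\<Sum>l\<in>L. P l (u l)) = (\<Sum>l\<in>L. P l (P l w))"
        using u by (simp add: bounded_clinear_simps(4)[OF G] flip: PG)
      also have "\<dots> = w" using sum_P[of w] P_idem by simp
      finally have "G \<mu> (\<Sum>l\<in>L. P l (u l)) = w" .
      moreover have "(\<Sum>l\<in>L. P l (u l)) \<in> combine W"
      proof (rule sum_in_combine)
        fix l assume l: "l \<in> L"
        have "u l \<in> W l" using u[OF l] by (rule conjunct1)
        then show "P l (u l) \<in> W l" by (rule hyperinvariantD[OF hyper[of l] P[of l] PT[of l]])
      qed
      ultimately show "\<exists>u\<in>combine W. T u + K u - \<mu> *\<^sub>C u = w" unfolding G_def by blast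
    next
      fix u assume u: "u \<in> combine W"
      have "norm u = norm (\<Sum>l\<in>L. P l u)" using sum_P by simp
      also have "\<dots> \<le> (\<Sum>l\<in>L. \<bar>c l\<bar> * b l * norm (G \<mu> u))"
      proof (rule sum_norm_le)
        fix l assume l: "l \<in> L"
        have "norm (P l u) \<le> c l * norm (G \<mu> (P l u))" using c[OF l] u l by (auto simp: combine_def)
        also have "\<dots> \<le> \<bar>c l\<bar> * (b l * norm (G \<mu> u))"
          unfolding PG[symmetric] by (intro mult_mono b(2)) auto
        finally show "norm (P l u) \<le> \<bar>c l\<bar> * b l * norm (G \<mu> u)" by simp
      qed
      finally show "norm u \<le> (\<Sum>l\<in>L. \<bar>c l\<bar> * b l) * norm (T u + K u - \<mu> *\<^sub>C u)"
        by (simp add: sum_distrib_right G_def)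
    qed (rule invariant_combine[of W, OF W hyper])
  qed
  then show ?thesis by blast
qed

lemma closed_invariant_subspace_combine:
  assumes "\<And>l. csubspace (W l)" "\<And>l. closed (W l)"
    and hyper: "\<And>l. hyperinvariant T (W l)"
  shows "closed_invariant_subspace (\<lambda>x. T x + K x) (combine W)"
  using invariant_combine[of W, OF assms(1) hyper] assms(1,2)
  by (simp add: closed_invariant_subspace_def closed_combine csubspace_combine)

lemma decomposable_add:
  assumes dec: "decomposable T"
  shows "decomposable (\<lambda>x. T x + K x)"
  unfolding decomposable_def
proof (intro conjI allI impI)
  show "bounded_clinear (\<lambda>x. T x + K x)" by (rule bounded_clinear_add[OF T K])
next
  fix U V :: "complex set" assume "open U \<and> open V \<and> U \<union> V = UNIV"
  then have UV: "open U" "open V" "U \<union> V = UNIV" by auto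
  have "\<exists>Y Z. csubspace Y \<and> closed Y \<and> csubspace Z \<and> closed Z \<and>
    hyperinvariant T Y \<and> hyperinvariant T Z \<and>
    (\<forall>x. \<exists>y\<in>Y. \<exists>z\<in>Z. x = y + z) \<and>
    spectrum_on Y T \<subseteq> {z. z + l \<in> U} \<and> spectrum_on Z T \<subseteq> {z. z + l \<in> V}" for l
  proof -
    have shift: "open {z. z + l \<in> A}" if "open A" for A
      using open_vimage[OF that, of "\<lambda>z. z + l"] by (simp add: vimage_def continuous_on_add)
    have cover: "{z. z + l \<in> U} \<union> {z. z + l \<in> V} = UNIV" using UV by auto
    show ?thesis
      by (rule decomposable_hyperinvariant[OF dec shift[OF UV(1)] shift[OF UV(2)] cover])
        (intro exI conjI; blast)
  qed
  then obtain Y Z where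
    Y: "\<And>l. csubspace (Y l)" "\<And>l. closed (Y l)" "\<And>l. hyperinvariant T (Y l)"
    and Z: "\<And>l. csubspace (Z l)" "\<And>l. closed (Z l)" "\<And>l. hyperinvariant T (Z l)"
    and YZ: "\<And>l x. \<exists>y\<in>Y l. \<exists>z\<in>Z l. x = y + z"
    and spec: "\<And>l. spectrum_on (Y l) T \<subseteq> {z. z + l \<in> U}" "\<And>l. spectrum_on (Z l) T \<subseteq> {z. z + l \<in> V}"
    by metis
  have "\<exists>y z. x = y + z \<and> y \<in> combine Y \<and> z \<in> combine Z" for x
  proof -
    \<comment> \<open>The same x is decomposed once for every l, and only the \<open>P l\<close>
      component of the l-th decomposition is kept; these components add up to x.\<close>
    obtain y z where yz: "\<And>l. y l \<in> Y l" "\<And>l. z l \<in> Z l" "\<And>l. x = y l + z l"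
      using YZ[of _ x] by metis
    have P_mem: "P l (y l) \<in> Y l" "P l (z l) \<in> Z l" for l
      by (rule hyperinvariantD[OF Y(3)[of l] P[of l] PT[of l] yz(1)[of l]],
          rule hyperinvariantD[OF Z(3)[of l] P[of l] PT[of l] yz(2)[of l]])
    have "x = (\<Sum>l\<in>L. P l (y l + z l))" using sum_P[of x] by (simp flip: yz(3))
    then have "x = (\<Sum>l\<in>L. P l (y l)) + (\<Sum>l\<in>L. P l (z l))"
      by (simp add: bounded_clinear_simps[OF P] sum.distrib)
    moreover have "(\<Sum>l\<in>L. P l (y l)) \<in> combine Y"
      by (rule sum_in_combine) (rule P_mem)
    moreover have "(\<Sum>l\<in>L. P l (z l)) \<in> combine Z"
      by (rule sum_in_combine) (rule P_mem)
    ultimately show ?thesis by blast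
  qed
  then have "{y + z | y z. y \<in> combine Y \<and> z \<in> combine Z} = UNIV" by blast
  then show "\<exists>Y Z. closed_invariant_subspace (\<lambda>x. T x + K x) Y \<and>
      closed_invariant_subspace (\<lambda>x. T x + K x) Z \<and> {y + z | y z. y \<in> Y \<and> z \<in> Z} = UNIV \<and>
      spectrum_on Y (\<lambda>x. T x + K x) \<subseteq> U \<and> spectrum_on Z (\<lambda>x. T x + K x) \<subseteq> V"
    using closed_invariant_subspace_combine[of Y, OF Y] closed_invariant_subspace_combine[of Z, OF Z]
      spectrum_on_combine[of Y U, OF Y(1,3) spec(1)] spectrum_on_combine[of Z V, OF Z(1,3) spec(2)]
    by (intro exI[of _ "combine Y"] exI[of _ "combine Z"] conjI)
qed

end

theorem corollary2p3:
  fixes T K :: "'a::complex_banach \<Rightarrow> 'a"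
  assumes "bounded_clinear T"
    and "decomposable T"
    and "bounded_clinear K"
    and "algebraic_operator K"
    and "T \<circ> K = K \<circ> T"
  shows "decomposable (\<lambda>x. T x + K x)"
proof -
  note T = assms(1) and K = assms(3)
  have TK: "T (K x) = K (T x)" for x using fun_cong[OF assms(5), of x] by simp
  obtain p where p: "p \<noteq> 0" "poly_op p K = (\<lambda>x. 0)"
    using assms(4) by (auto simp: algebraic_operator_def)
  obtain L e where L: "finite L" and e: "p dvd (\<Sum>l\<in>L. e l) - 1"
    "\<And>l k. l \<in> L \<Longrightarrow> k \<in> L \<Longrightarrow> l \<noteq> k \<Longrightarrow> p dvd e l * e k"
    "\<And>l. l \<in> L \<Longrightarrow> \<exists>m. p dvd [:- l, 1:] ^ m * e l"
    using poly_spectral_idempotents[OF p(1)] by blast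
  define P where "P = (\<lambda>l. poly_op (e l) K)"
  interpret commuting_idempotents T K L P
  proof
    show "bounded_clinear (P l)" for l unfolding P_def by (rule bounded_clinear_poly_op[OF K])
    show "P l (T x) = T (P l x)" for l x
      unfolding P_def by (rule poly_op_commute[OF T K TK, symmetric])
    show "P l (K x) = K (P l x)" for l x
      unfolding P_def by (rule poly_op_commute[OF K K refl, symmetric])
    show "(\<Sum>l\<in>L. P l x) = x" for x
      using poly_op_dvd[OF K p(2) e(1), of x] by (simp add: P_def poly_op_diff poly_op_sum)
    show "P l (P k x) = 0" if "l \<in> L" "k \<in> L" "l \<noteq> k" for l k x
      using poly_op_dvd[OF K p(2) e(2)[OF that], of x] by (simp add: P_def poly_op_mult[OF K])
    show "\<exists>m. \<forall>x. ((\<lambda>x. K x - l *\<^sub>C x) ^^ m) (P l x) = 0" if l: "l \<in> L" for l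
    proof -
      obtain m where m: "p dvd [:- l, 1:] ^ m * e l" using e(3)[OF l] by blast
      have "((\<lambda>x. K x - l *\<^sub>C x) ^^ m) (P l x) = 0" for x
        using poly_op_dvd[OF K p(2) m, of x]
        by (simp add: P_def poly_op_mult[OF K] poly_op_linear_power[OF K])
      then show ?thesis by blast
    qed
  qed (use T K TK L in auto)
  show ?thesis by (rule decomposable_add[OF assms(2)])
qed

end
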